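(* Let $(\Sigma_A,\theta)$ be a topologically mixing topological Markov chain, let $G$ be a countable discrete group, let $\psi:\Sigma_A\to G$ be constant on cylinders of length one, and let $(X,T)$ be the associated $G$-extension, $X=\Sigma_A\times G$, $T(x,g)=(\theta x,g\psi(x))$. Assume that $T$ is topologically transitive, that $(\Sigma_A,\theta,\psi)$ is symmetric, that $\varphi:\Sigma_A\to(0,\infty)$ is a weakly symmetric potential, and that the Gurevič pressure $P_G(\theta,\varphi)$ is finite. If $G$ is an amenable group, then $P_G(T,\varphi)=P_G(\theta,\varphi)$.
   Context: Topological Markov chain: let $I$ be a countable alphabet and $A=(a_{ij})_{i,j\in I}$ a matrix with entries in $\{0,1\}$ and $\sum_j a_{ij}>0$ for all $i$. Then $\Sigma_A=\{(w_k)_{k\ge 0}: w_k\in I,\ a_{w_kw_{k+1}}=1\ \forall k\}$ with the topology generated by cylinders, and $\theta$ is the one-sided (left) shift. A word of length $n$ is $w=(w_1\ldots w_n)\in I^n$ with $a_{w_kw_{k+1}}=1$ for $1\le k<n$; such words are called admissible, $\mathcal W^n$ is the set of words of length $n$, $\mathcal W^\infty=\bigcup_n\mathcal W^n$, and $[w]\subset\Sigma_A$ is the cylinder of sequences beginning with $w$. A topological Markov chain is topologically transitive if for all states $a,b$ there is $n$ such that there is an admissible word $w$ of length $n$ starting with $a$ with $wb$ admissible; it is topologically mixing if for all $a,b$ such a word exists for all sufficiently large $n$. Group extension: $(X,T)$ is itself a topological Markov chain with cylinders $[w]\times\{g\}$, and states $(a,g)$, $a\in\mathcal W^1$, $g\in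 G$; transitivity of $T$ is understood in this sense. Put $\psi_n(x)=\psi(x)\psi(\theta x)\cdots\psi(\theta^{n-1}x)$; for $w\in\mathcal W^n$, $\psi(w)$ denotes the constant value of $\psi_n$ on $[w]$. Symmetry: $(\Sigma_A,\theta,\psi)$ is symmetric if there is a map $\mathcal W^1\to\mathcal W^1$, $w\mapsto w^\dagger$, such that $(w^\dagger)^\dagger=w$ for all $w$; $(vw)$ is admissible if and only if $(w^\dagger v^\dagger)$ is admissible, for all $v,w\in\mathcal W^1$; and $\psi(v^\dagger)=\psi(v)^{-1}$ for all $v\in\mathcal W^1$. It is extended to $\mathcal W^\infty$ by $(w_1\ldots w_n)^\dagger=(w_n^\dagger\ldots w_1^\dagger)$. Potential: a potential is a strictly positive function $\varphi$ on $\Sigma_A$; $\Phi_n=\prod_{k=0}^{n-1}\varphi\circ\theta^k$. It is weakly symmetric (with respect to $\dagger$) if $\varphi$ is continuous and there is a sequence $(D_n)$ with $\lim_n D_n^{1/n}=1$ such that $\sup_{x\in[w],\,y\in[w^\dagger]}\Phi_n(x)/\Phi_n(y)\le D_n$ for all $n$ and all $w\in\mathcal W^n$. The potential is lifted to $X$ by $\varphi(x,g)=\varphi(x)$. Gurevič pressure: for $a\in\mathcal W^1$, $$P_G(\theta,\varphi)=\limsup_{n\to\infty}\frac1n\log\sum_{\theta^n(x)=x,\ x\in[a]}\Phi_n(x),\qquad P_G(T,\varphi)=\limsup_{n\to\infty}\frac1n\log\sum_{T^n(x,\mathrm{id})=(x,\mathrm{id}),\ x\in[a]}\Phi_n(x),$$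 where $\mathrm{id}$ is the identity of $G$ and $\log 0=-\infty$; under the present assumptions these values do not depend on $a$. Amenable: $G$ is amenable if there is a sequence $(K_n)$ of finite nonempty subsets of $G$ with $\bigcup_nK_n=G$ and $\lim_n|gK_n\triangle K_n|/|K_n|=0$ for all $g\in G$. *)

theory Defs
  imports "HOL-Analysis.Analysis" "HOL-Algebra.Coset"
begin

text \<open>Row sums may be infinite; they are positive iff the row has a positive entry.\<close>

definition transition_matrix :: "'i set \<Rightarrow> ('i \<Rightarrow> 'i \<Rightarrow> nat) \<Rightarrow> bool" where
  "transition_matrix I A \<longleftrightarrow>
     countable I \<and> (\<forall>i\<in>I. \<forall>j\<in>I. A i j \<in> {0, 1}) \<and> (\<forall>i\<in>I. \<exists>j\<in>I. A i j > 0)"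

definition markov_space :: "'i set \<Rightarrow> ('i \<Rightarrow> 'i \<Rightarrow> nat) \<Rightarrow> (nat \<Rightarrow> 'i) set" where
  "markov_space I A = {x. (\<forall>k. x k \<in> I) \<and> (\<forall>k. A (x k) (x (Suc k)) = 1)}"

definition shift :: "(nat \<Rightarrow> 'i) \<Rightarrow> (nat \<Rightarrow> 'i)" where
  "shift x = (\<lambda>k. x (Suc k))"

text \<open>The empty list is never a word, so there are no words of length 0.\<close>

definition words :: "'i set \<Rightarrow> ('i \<Rightarrow> 'i \<Rightarrow> nat) \<Rightarrow> nat \<Rightarrow> 'i list set" where
  "words I A n =
     {w. w \<noteq> [] \<and> length w = n \<and> set w \<subseteq> I \<and> (\<forall>k. Suc k < n \<longrightarrow> A (w ! k) (w ! Suc k) = 1)}"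

definition cylinder :: "'i set \<Rightarrow> ('i \<Rightarrow> 'i \<Rightarrow> nat) \<Rightarrow> 'i list \<Rightarrow> (nat \<Rightarrow> 'i) set" where
  "cylinder I A w = {x \<in> markov_space I A. \<forall>k<length w. x k = w ! k}"

definition markov_topology :: "'i set \<Rightarrow> ('i \<Rightarrow> 'i \<Rightarrow> nat) \<Rightarrow> (nat \<Rightarrow> 'i) topology" where
  "markov_topology I A = topology_generated_by (\<Union>n. cylinder I A ` words I A n)"

definition chain_transitive :: "'i set \<Rightarrow> ('i \<Rightarrow> 'i \<Rightarrow> nat) \<Rightarrow> bool" where
  "chain_transitive I A \<longleftrightarrow>
     (\<forall>a\<in>I. \<forall>b\<in>I. \<exists>n. \<exists>w\<in>words I A n. hd w = a \<and> w @ [b] \<in> words I A (Suc n))"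

definition chain_mixing :: "'i set \<Rightarrow> ('i \<Rightarrow> 'i \<Rightarrow> nat) \<Rightarrow> bool" where
  "chain_mixing I A \<longleftrightarrow>
     (\<forall>a\<in>I. \<forall>b\<in>I. \<exists>N. \<forall>n\<ge>N. \<exists>w\<in>words I A n. hd w = a \<and> w @ [b] \<in> words I A (Suc n))"

definition constant_on_letters ::
    "'i set \<Rightarrow> ('i \<Rightarrow> 'i \<Rightarrow> nat) \<Rightarrow> ((nat \<Rightarrow> 'i) \<Rightarrow> 'b) \<Rightarrow> bool" where
  "constant_on_letters I A \<psi> \<longleftrightarrow>
     (\<forall>a\<in>I. \<forall>x\<in>cylinder I A [a]. \<forall>y\<in>cylinder I A [a]. \<psi> x = \<psi> y)"

text \<open>The value of \<open>\<psi>\<close> on the cylinder of a letter; meaningful if \<open>\<psi>\<close> is constant there.\<close>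

definition letter_value ::
    "'i set \<Rightarrow> ('i \<Rightarrow> 'i \<Rightarrow> nat) \<Rightarrow> ((nat \<Rightarrow> 'i) \<Rightarrow> 'b) \<Rightarrow> 'i \<Rightarrow> 'b" where
  "letter_value I A \<psi> a = the_elem (\<psi> ` cylinder I A [a])"

definition extension_map ::
    "('g, 'm) monoid_scheme \<Rightarrow> ((nat \<Rightarrow> 'i) \<Rightarrow> 'g) \<Rightarrow> (nat \<Rightarrow> 'i) \<times> 'g \<Rightarrow> (nat \<Rightarrow> 'i) \<times> 'g" where
  "extension_map G \<psi> = (\<lambda>(x, g). (shift x, g \<otimes>\<^bsub>G\<^esub> \<psi> x))"

text \<open>The space \<open>\<Sigma>\<^sub>A \<times> G\<close> with the map above is the topological Markov chain on the states
  \<open>I \<times> G\<close> in which \<open>(a, g)\<close> can be followed by \<open>(b, h)\<close> iff \<open>b\<close> can follow \<open>a\<close> and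
  \<open>h = g \<psi>(a)\<close>: the point \<open>(x, g)\<close> corresponds to the sequence of states
  \<open>(x k, g \<psi>\<^sub>k(x))\<close>.\<close>

definition extension_matrix ::
    "'i set \<Rightarrow> ('i \<Rightarrow> 'i \<Rightarrow> nat) \<Rightarrow> ('g, 'm) monoid_scheme \<Rightarrow> ((nat \<Rightarrow> 'i) \<Rightarrow> 'g)
      \<Rightarrow> 'i \<times> 'g \<Rightarrow> 'i \<times> 'g \<Rightarrow> nat" where
  "extension_matrix I A G \<psi> =
     (\<lambda>(a, g) (b, h). if A a b = 1 \<and> h = g \<otimes>\<^bsub>G\<^esub> letter_value I A \<psi> a then 1 else 0)"

definition extension_transitive ::
    "'i set \<Rightarrow> ('i \<Rightarrow> 'i \<Rightarrow> nat) \<Rightarrow> ('g, 'm) monoid_scheme \<Rightarrow> ((nat \<Rightarrow> 'i) \<Rightarrow> 'g) \<Rightarrow> bool" where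
  "extension_transitive I A G \<psi> \<longleftrightarrow>
     chain_transitive (I \<times> carrier G) (extension_matrix I A G \<psi>)"

definition symmetric_extension ::
    "'i set \<Rightarrow> ('i \<Rightarrow> 'i \<Rightarrow> nat) \<Rightarrow> ('g, 'm) monoid_scheme \<Rightarrow> ((nat \<Rightarrow> 'i) \<Rightarrow> 'g)
      \<Rightarrow> ('i \<Rightarrow> 'i) \<Rightarrow> bool" where
  "symmetric_extension I A G \<psi> dag \<longleftrightarrow>
     (\<forall>v\<in>I. dag v \<in> I \<and> dag (dag v) = v) \<and>
     (\<forall>v\<in>I. \<forall>w\<in>I. [v, w] \<in> words I A 2 \<longleftrightarrow> [dag w, dag v] \<in> words I A 2) \<and>
     (\<forall>v\<in>I. letter_value I A \<psi> (dag v) = inv\<^bsub>G\<^esub> (letter_value I A \<psi> v))"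

definition word_dag :: "('i \<Rightarrow> 'i) \<Rightarrow> 'i list \<Rightarrow> 'i list" where
  "word_dag dag w = rev (map dag w)"

definition orbit_prod :: "('x \<Rightarrow> 'x) \<Rightarrow> ('x \<Rightarrow> real) \<Rightarrow> nat \<Rightarrow> 'x \<Rightarrow> real" where
  "orbit_prod T \<phi> n x = (\<Prod>k<n. \<phi> ((T ^^ k) x))"

text \<open>The supremum of the quotients over \<open>[w] \<times> [w\<^sup>\<dagger>]\<close> being at most \<open>D n\<close> is spelled out
  pointwise. Convergence of the roots to 1 forces \<open>D n > 0\<close> for all large \<open>n\<close>.\<close>

definition weakly_symmetric ::
    "'i set \<Rightarrow> ('i \<Rightarrow> 'i \<Rightarrow> nat) \<Rightarrow> ('i \<Rightarrow> 'i) \<Rightarrow> ((nat \<Rightarrow> 'i) \<Rightarrow> real) \<Rightarrow> bool" where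
  "weakly_symmetric I A dag \<phi> \<longleftrightarrow>
     continuous_map (markov_topology I A) euclideanreal \<phi> \<and>
     (\<exists>D :: nat \<Rightarrow> real. (\<lambda>n. root n (D n)) \<longlonglongrightarrow> 1 \<and>
        (\<forall>n. \<forall>w\<in>words I A n. \<forall>x\<in>cylinder I A w. \<forall>y\<in>cylinder I A (word_dag dag w).
           orbit_prod shift \<phi> n x / orbit_prod shift \<phi> n y \<le> D n))"

definition extended_ln :: "ennreal \<Rightarrow> ereal" where
  "extended_ln s = (if s = 0 then - \<infinity> else if s = \<infinity> then \<infinity> else ereal (ln (enn2real s)))"

text \<open>Exponential growth rate of the weighted number of points of \<open>C\<close> that are fixed by
  \<open>T\<^sup>n\<close>. The sums are unordered sums in \<open>[0, \<infinity>]\<close>; the term for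
  \<open>n = 0\<close> does not affect the limit.\<close>

definition periodic_growth :: "('x \<Rightarrow> 'x) \<Rightarrow> ('x \<Rightarrow> real) \<Rightarrow> 'x set \<Rightarrow> ereal" where
  "periodic_growth T \<phi> C =
     limsup (\<lambda>n. extended_ln (\<Sum>\<^sub>\<infinity>x\<in>{x \<in> C. (T ^^ n) x = x}. ennreal (orbit_prod T \<phi> n x))
                   / ereal (real n))"

definition gurevic_pressure ::
    "'i set \<Rightarrow> ('i \<Rightarrow> 'i \<Rightarrow> nat) \<Rightarrow> ((nat \<Rightarrow> 'i) \<Rightarrow> real) \<Rightarrow> 'i \<Rightarrow> ereal" where
  "gurevic_pressure I A \<phi> a = periodic_growth shift \<phi> (cylinder I A [a])"

definition extension_gurevic_pressure ::
    "'i set \<Rightarrow> ('i \<Rightarrow> 'i \<Rightarrow> nat) \<Rightarrow> ('g, 'm) monoid_scheme \<Rightarrow> ((nat \<Rightarrow> 'i) \<Rightarrow> 'g)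
      \<Rightarrow> ((nat \<Rightarrow> 'i) \<Rightarrow> real) \<Rightarrow> 'i \<Rightarrow> ereal" where
  "extension_gurevic_pressure I A G \<psi> \<phi> a =
     periodic_growth (extension_map G \<psi>) (\<lambda>(x, g). \<phi> x) (cylinder I A [a] \<times> {\<one>\<^bsub>G\<^esub>})"

definition amenable :: "('g, 'm) monoid_scheme \<Rightarrow> bool" where
  "amenable G \<longleftrightarrow>
     (\<exists>K :: nat \<Rightarrow> 'g set.
        (\<forall>n. finite (K n) \<and> K n \<noteq> {} \<and> K n \<subseteq> carrier G) \<and>
        (\<Union>n. K n) = carrier G \<and>
        (\<forall>g\<in>carrier G.
           (\<lambda>n. real (card (sym_diff (g <#\<^bsub>G\<^esub> K n) (K n))) / real (card (K n))) \<longlonglongrightarrow> 0))"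

end

theory Submission
  imports Defs
begin

text \<open>
  Every fixed point of \<open>T\<^sup>n\<close> over \<open>[a] \<times> {id}\<close> is a fixed point of \<open>\<theta>\<^sup>n\<close> in \<open>[a]\<close>, so only the
  inequality \<open>P\<^sub>G(\<theta>, \<phi>) \<le> P\<^sub>G(T, \<phi>)\<close> has content. The idea is to find, inside the
  periodic orbits of \<open>T\<close>, a symmetric random walk on \<open>G\<close> and to use the easy half of Kesten's
  theorem: on an amenable group such a walk returns to the identity with a probability that decays
  subexponentially.

  The walk. Symmetry turns a closed path \<open>y\<close> at \<open>a\<close> into a closed path at \<open>a\<^sup>\<dagger>\<close> whose value in
  \<open>G\<close> is conjugate to \<open>\<psi>(y)\<^sup>-\<^sup>1\<close>. Transitivity of \<open>T\<close> supplies connecting words \<open>u\<close> from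
  \<open>a\<close> to \<open>a\<^sup>\<dagger>\<close> and \<open>v\<close> back whose values undo this conjugation. So any two closed paths
  \<open>x\<close>, \<open>y\<close> of length \<open>n\<close> at \<open>a\<close> combine to a closed block \<open>x u y\<^sup>\<dagger> v\<close> at \<open>a\<close> with
  value \<open>\<psi>(x) \<psi>(y)\<^sup>-\<^sup>1\<close>; exchanging \<open>x\<close> and \<open>y\<close> inverts the value. By weak symmetry the
  weight of the block is, up to the factor \<open>c D\<^sub>n\<^sup>-\<^sup>3\<close> with \<open>c\<close> independent of \<open>n\<close>, at least
  \<open>\<Phi>\<^sub>n(x) \<Phi>\<^sub>n(y)\<close>, and such bounds multiply when blocks are concatenated
  (\<open>return_path\<close>, \<open>cylinder_bound_append\<close>).

  The group. Let the block weights have total mass \<open>M\<^sup>2\<close>, where \<open>M\<close> is the sum of \<open>\<Phi>\<^sub>n\<close> over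
  finitely many fixed points. Testing the convolution operator of the symmetric walk on the indicator
  of an almost invariant set and applying the Cauchy-Schwarz inequality repeatedly shows that the
  mass of the closed walks with \<open>m = 2\<^sup>j\<close> steps is at least \<open>\<kappa> (M\<^sup>2 / 2)\<^sup>m\<close>, with
  \<open>\<kappa> > 0\<close> independent of \<open>j\<close> (\<open>amenable_return_mass\<close>).

  The limit. Closed walks with \<open>m\<close> steps give distinct fixed points of \<open>T\<^sup>m\<^sup>N\<close> over
  \<open>[a] \<times> {id}\<close>, where \<open>N = 2 n + |u| + |v|\<close> (\<open>fixed_point_sum_ge\<close>). Letting \<open>j\<close> tend to
  infinity,
  \<open>P\<^sub>G(T, \<phi>) \<ge> (2 ln M - 3 ln D\<^sub>n + ln (c / 2)) / (2 n + |u| + |v|)\<close>.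
  If \<open>b < P\<^sub>G(\<theta>, \<phi>)\<close>, then for infinitely many \<open>n\<close> the fixed points can be chosen with
  \<open>ln M > n b\<close>; since \<open>ln D\<^sub>n = o(n)\<close>, the right-hand side gets arbitrarily close to \<open>b\<close>
  or exceeds it.
\<close>

section \<open>Return of symmetric walks on amenable groups\<close>

definition word_value :: "('g, 'm) monoid_scheme \<Rightarrow> ('e \<Rightarrow> 'g) \<Rightarrow> 'e list \<Rightarrow> 'g" where
  "word_value G s xs = foldr (\<lambda>e g. s e \<otimes>\<^bsub>G\<^esub> g) xs \<one>\<^bsub>G\<^esub>"

context group
begin

lemma word_value_simps [simp]:
  "word_value G s [] = \<one>" "word_value G s (e # xs) = s e \<otimes> word_value G s xs"
  by (simp_all add: word_value_def)

lemma word_value_closed: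
  "s ` set xs \<subseteq> carrier G \<Longrightarrow> word_value G s xs \<in> carrier G"
  by (induction xs) auto

lemma word_value_append:
  "s ` set xs \<subseteq> carrier G \<Longrightarrow> s ` set ys \<subseteq> carrier G \<Longrightarrow>
     word_value G s (xs @ ys) = word_value G s xs \<otimes> word_value G s ys"
  by (induction xs) (auto simp: m_assoc word_value_closed)

lemma word_value_concat:
  "(\<forall>xs\<in>set xss. s ` set xs \<subseteq> carrier G) \<Longrightarrow>
     word_value G s (concat xss) = word_value G (word_value G s) xss"
  by (induction xss) (auto simp: word_value_append image_subset_iff)

lemma word_value_rev_inverse:
  assumes "s ` set xs \<subseteq> carrier G" and "\<And>e. e \<in> set xs \<Longrightarrow> s (r e) = inv (s e)"
  shows "word_value G s (rev (map r xs)) = inv (word_value G s xs)"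
  using assms
proof (induction xs)
  case (Cons e xs)
  have "s ` set (rev (map r xs)) \<subseteq> carrier G"
    using Cons.prems by auto
  then have "word_value G s (rev (map r (e # xs)))
      = word_value G s (rev (map r xs)) \<otimes> inv (s e)"
    using Cons.prems by (simp add: word_value_append)
  also have "\<dots> = inv (word_value G s (e # xs))"
    using Cons by (simp add: inv_mult_group word_value_closed)
  finally show ?case .
qed simp

end

text \<open>The mass of coincidences \<open>t i = t' j\<close> is the inner product of the two distributions on \<open>H\<close>
  that \<open>t\<close> and \<open>t'\<close> induce. In this form the Hilbert space arguments on \<open>\<ell>\<^sup>2(G)\<close> become
  statements about finite sums.\<close>

lemma sum_coincidences:
  fixes \<omega> :: "'i \<Rightarrow> real" and \<omega>' :: "'j \<Rightarrow> real"
  assumes "finite J" "finite J'" "finite H" "t ` J \<subseteq> H"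
  shows "(\<Sum>i\<in>J. \<Sum>j\<in>J'. if t i = t' j then \<omega> i * \<omega>' j else 0)
    = (\<Sum>h\<in>H. (\<Sum>i | i \<in> J \<and> t i = h. \<omega> i) * (\<Sum>j | j \<in> J' \<and> t' j = h. \<omega>' j))"
proof -
  have "(\<Sum>h\<in>H. (\<Sum>i | i \<in> J \<and> t i = h. \<omega> i) * (\<Sum>j | j \<in> J' \<and> t' j = h. \<omega>' j))
      = (\<Sum>h\<in>H. \<Sum>i | i \<in> J \<and> t i = h. \<omega> i * (\<Sum>j | j \<in> J' \<and> t' j = t i. \<omega>' j))"
    by (simp add: sum_distrib_right)
  also have "\<dots> = (\<Sum>i\<in>J. \<omega> i * (\<Sum>j | j \<in> J' \<and> t' j = t i. \<omega>' j))"
    using assms by (intro sum.group) auto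
  also have "\<dots> = (\<Sum>i\<in>J. \<Sum>j\<in>J'. if t i = t' j then \<omega> i * \<omega>' j else 0)"
    using assms
    by (intro sum.cong refl)
       (auto simp: sum_distrib_left sum.inter_filter eq_commute intro!: sum.cong)
  finally show ?thesis by simp
qed

lemma sum_pairs_filter:
  fixes f :: "'i \<Rightarrow> 'j \<Rightarrow> real"
  assumes "finite A" "finite B"
  shows "(\<Sum>(x, y) | (x, y) \<in> A \<times> B \<and> P x y. f x y)
    = (\<Sum>x\<in>A. \<Sum>y\<in>B. if P x y then f x y else 0)"
proof -
  have "{(x, y). (x, y) \<in> A \<times> B \<and> P x y} = {p \<in> A \<times> B. P (fst p) (snd p)}"
    by auto
  then show ?thesis
    using assms by (simp add: sum.inter_filter sum.cartesian_product case_prod_beta)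
qed

text \<open>With \<open>m\<close>, \<open>m'\<close> the induced distributions, this is \<open>2 m m' \<le> m\<^sup>2 + m'\<^sup>2\<close> summed over all
  values.\<close>

lemma two_coincidences_le:
  fixes \<omega> :: "'i \<Rightarrow> real"
  assumes "finite J"
  shows "2 * (\<Sum>i\<in>J. \<Sum>j\<in>J. if t i = t' j then \<omega> i * \<omega> j else 0)
    \<le> (\<Sum>i\<in>J. \<Sum>j\<in>J. if t i = t j then \<omega> i * \<omega> j else 0)
      + (\<Sum>i\<in>J. \<Sum>j\<in>J. if t' i = t' j then \<omega> i * \<omega> j else 0)"
proof -
  define H where "H = t ` J \<union> t' ` J"
  define m where "m h = (\<Sum>i | i \<in> J \<and> t i = h. \<omega> i)" for h
  define m' where "m' h = (\<Sum>i | i \<in> J \<and> t' i = h. \<omega> i)" for h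
  have H: "finite H" "t ` J \<subseteq> H" "t' ` J \<subseteq> H"
    using assms by (auto simp: H_def)
  have "2 * (\<Sum>h\<in>H. m h * m' h) = (\<Sum>h\<in>H. 2 * (m h * m' h))"
    by (simp add: sum_distrib_left)
  also have "\<dots> \<le> (\<Sum>h\<in>H. m h * m h + m' h * m' h)"
  proof (rule sum_mono)
    fix h
    have "0 \<le> (m h - m' h)^2" by simp
    then show "2 * (m h * m' h) \<le> m h * m h + m' h * m' h"
      by (simp add: power2_eq_square algebra_simps)
  qed
  finally show ?thesis
    using sum_coincidences[OF assms assms H(1,2), of t \<omega> \<omega>]
      sum_coincidences[OF assms assms H(1,2), of t' \<omega> \<omega>]
      sum_coincidences[OF assms assms H(1,3), of t' \<omega> \<omega>]
    by (simp add: sum.distrib m_def m'_def)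
qed

text \<open>The Cauchy-Schwarz inequality for the distribution induced by \<open>t\<close> and the indicator of \<open>K\<close>.\<close>

lemma coincidences_ge:
  fixes \<omega> :: "'i \<Rightarrow> real"
  assumes "finite J" "finite K"
  shows "(\<Sum>i | i \<in> J \<and> t i \<in> K. \<omega> i)\<^sup>2
    \<le> real (card K) * (\<Sum>i\<in>J. \<Sum>j\<in>J. if t i = t j then \<omega> i * \<omega> j else 0)"
proof -
  define H where "H = t ` J \<union> K"
  define m where "m h = (\<Sum>i | i \<in> J \<and> t i = h. \<omega> i)" for h
  have H: "finite H" "t ` J \<subseteq> H" "K \<subseteq> H"
    using assms by (auto simp: H_def)
  have "(\<Sum>i | i \<in> J \<and> t i \<in> K. \<omega> i) = (\<Sum>h\<in>K. \<Sum>i | i \<in> {i \<in> J. t i \<in> K} \<and> t i = h. \<omega> i)"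
    using assms by (intro sum.group[symmetric]) auto
  also have "\<dots> = (\<Sum>h\<in>K. m h)"
    unfolding m_def by (intro sum.cong refl) auto
  finally have "(\<Sum>i | i \<in> J \<and> t i \<in> K. \<omega> i)\<^sup>2 = (\<Sum>h\<in>K. m h)\<^sup>2"
    by simp
  also have "\<dots> \<le> real (card K) * (\<Sum>h\<in>K. (m h)\<^sup>2)"
    using Cauchy_Schwarz_ineq_sum[of "\<lambda>_. 1" m K] by simp
  also have "\<dots> \<le> real (card K) * (\<Sum>h\<in>H. (m h)\<^sup>2)"
    using H by (intro mult_left_mono sum_mono2) auto
  finally show ?thesis
    using sum_coincidences[OF assms(1,1) H(1,2), of t \<omega> \<omega>]
    by (simp add: m_def power2_eq_square)
qed

text \<open>A finitely supported symmetric measure on a group, presented by labelled steps: several steps may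
  have the same value in the group, and the involution \<open>r\<close> on the labels witnesses the symmetry.
  Keeping the labels lets a walk be decoded into the steps that it consists of.\<close>

locale symmetric_walk = group G for G (structure) +
  fixes E :: "'e set" and \<omega> :: "'e \<Rightarrow> real" and s :: "'e \<Rightarrow> 'a" and r :: "'e \<Rightarrow> 'e"
  assumes finite_steps: "finite E"
    and weight_nonneg: "e \<in> E \<Longrightarrow> 0 \<le> \<omega> e"
    and step_closed: "e \<in> E \<Longrightarrow> s e \<in> carrier G"
    and reverse_step: "e \<in> E \<Longrightarrow> r e \<in> E"
    and reverse_reverse: "e \<in> E \<Longrightarrow> r (r e) = e"
    and weight_reverse: "e \<in> E \<Longrightarrow> \<omega> (r e) = \<omega> e"
    and step_reverse: "e \<in> E \<Longrightarrow> s (r e) = inv (s e)"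
begin

definition steps :: "nat \<Rightarrow> 'e list set" where
  "steps m = {xs. set xs \<subseteq> E \<and> length xs = m}"

definition weight :: "'e list \<Rightarrow> real" where
  "weight xs = prod_list (map \<omega> xs)"

abbreviation val :: "'e list \<Rightarrow> 'a" where
  "val \<equiv> word_value G s"

definition walk_mass :: "nat \<Rightarrow> 'a \<Rightarrow> real" where
  "walk_mass m g = (\<Sum>xs | xs \<in> steps m \<and> val xs = g. weight xs)"

lemma finite_walks: "finite (steps m)"
  unfolding steps_def by (rule finite_lists_length_eq[OF finite_steps])

lemma weight_walk_nonneg: "xs \<in> steps m \<Longrightarrow> 0 \<le> weight xs"
  unfolding weight_def steps_def
  by (intro prod_list_nonneg) (auto intro: weight_nonneg)

lemma walk_mass_nonneg: "0 \<le> walk_mass m g"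
  unfolding walk_mass_def by (intro sum_nonneg) (auto intro: weight_walk_nonneg)

lemma val_closed: "xs \<in> steps m \<Longrightarrow> val xs \<in> carrier G"
  by (intro word_value_closed) (auto simp: steps_def intro: step_closed)

lemma reverse_walk:
  assumes "xs \<in> steps m"
  shows "rev (map r xs) \<in> steps m" "rev (map r (rev (map r xs))) = xs"
    "weight (rev (map r xs)) = weight xs" "val (rev (map r xs)) = inv (val xs)"
proof -
  have xs: "set xs \<subseteq> E" "length xs = m"
    using assms by (auto simp: steps_def)
  show "rev (map r xs) \<in> steps m"
    using xs by (auto simp: steps_def reverse_step)
  show "rev (map r (rev (map r xs))) = xs"
    using xs by (auto simp: rev_map intro!: map_idI reverse_reverse)
  have "map \<omega> (map r xs) = map \<omega> xs"
    using xs by (auto simp: weight_reverse)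
  then show "weight (rev (map r xs)) = weight xs"
    by (simp add: weight_def rev_map[symmetric] del: map_map)
  show "val (rev (map r xs)) = inv (val xs)"
    using xs by (intro word_value_rev_inverse) (auto intro: step_closed step_reverse)
qed

text \<open>A walk of length \<open>2 m\<close> is a walk \<open>xs\<close> of length \<open>m\<close> followed by the reversal of another
  walk \<open>zs\<close> of length \<open>m\<close>, so that its value is \<open>val xs \<otimes> inv (val zs)\<close>. This is how symmetry
  turns masses of even length into masses of coincidences.\<close>

lemma walk_mass_double:
  assumes "g \<in> carrier G"
  shows "walk_mass (2 * m) g
    = (\<Sum>xs\<in>steps m. \<Sum>zs\<in>steps m.
         if val xs = g \<otimes> val zs then weight xs * weight zs else 0)"
proof -
  have iff: "val xs \<otimes> inv (val zs) = g \<longleftrightarrow> val xs = g \<otimes> val zs"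
    if "xs \<in> steps m" "zs \<in> steps m" for xs zs
    using that assms val_closed by (intro inv_solve_right') auto
  have valapp: "val (xs @ rev (map r zs)) = val xs \<otimes> inv (val zs)"
    if "xs \<in> steps m" "zs \<in> steps m" for xs zs
  proof -
    have "s ` set xs \<subseteq> carrier G" "s ` set (rev (map r zs)) \<subseteq> carrier G"
      using that reverse_walk(1)[OF that(2)] by (auto simp: steps_def intro: step_closed reverse_step)
    then show ?thesis
      by (simp add: word_value_append reverse_walk(4)[OF that(2)])
  qed
  have "walk_mass (2 * m) g
      = (\<Sum>(xs, zs) | (xs, zs) \<in> steps m \<times> steps m \<and> val xs = g \<otimes> val zs. weight xs * weight zs)"
    unfolding walk_mass_def
  proof (rule sum.reindex_bij_witness[where i = "\<lambda>(xs, zs). xs @ rev (map r zs)"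
        and j = "\<lambda>ys. (take m ys, rev (map r (drop m ys)))"], goal_cases)
    case (1 ys)
    then have "drop m ys \<in> steps m"
      by (auto simp: steps_def dest: in_set_dropD)
    then show ?case
      using reverse_walk(2)[of "drop m ys" m] by simp
  next
    case (2 ys)
    then have t: "take m ys \<in> steps m" and d: "drop m ys \<in> steps m"
      by (auto simp: steps_def dest: in_set_dropD in_set_takeD)
    have "take m ys @ rev (map r (rev (map r (drop m ys)))) = ys"
      using reverse_walk(2)[OF d] by simp
    then have "val (take m ys) \<otimes> inv (val (rev (map r (drop m ys)))) = g"
      using valapp[OF t reverse_walk(1)[OF d]] 2 by simp
    then show ?case
      using t reverse_walk(1)[OF d] iff[OF t reverse_walk(1)[OF d]] by simp
  next
    case (3 p)
    then obtain xs zs where p: "p = (xs, zs)" "xs \<in> steps m" "zs \<in> steps m"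
      by auto
    then show ?case
      using reverse_walk(2)[OF p(3)] by (simp add: steps_def)
  next
    case (4 p)
    then obtain xs zs where p: "p = (xs, zs)" "xs \<in> steps m" "zs \<in> steps m" "val xs = g \<otimes> val zs"
      by auto
    then show ?case
      using reverse_walk(1)[OF p(3)] valapp[OF p(2,3)] iff[OF p(2,3)]
      by (auto simp: steps_def)
  next
    case (5 ys)
    then have d: "drop m ys \<in> steps m"
      by (auto simp: steps_def dest: in_set_dropD)
    have "weight (take m ys) * weight (drop m ys) = weight ys"
      by (simp add: weight_def flip: prod_list.append map_append)
    then show ?case
      using reverse_walk(3)[OF d] by simp
  qed
  also have "\<dots> = (\<Sum>xs\<in>steps m. \<Sum>zs\<in>steps m.
      if val xs = g \<otimes> val zs then weight xs * weight zs else 0)"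
    by (rule sum_pairs_filter[OF finite_walks finite_walks])
  finally show ?thesis .
qed

text \<open>An even convolution power of a symmetric measure is largest at the identity: left translation by
  \<open>g\<close> preserves the mass of coincidences, so both terms on the right of
  \<open>two_coincidences_le\<close> are the return mass.\<close>

lemma walk_mass_le_return:
  assumes "g \<in> carrier G"
  shows "walk_mass (2 * m) g \<le> walk_mass (2 * m) \<one>"
proof -
  have "g \<otimes> val xs = g \<otimes> val zs \<longleftrightarrow> val xs = val zs" if "xs \<in> steps m" "zs \<in> steps m" for xs zs
    using that assms val_closed by simp
  then have "(\<Sum>xs\<in>steps m. \<Sum>zs\<in>steps m. if g \<otimes> val xs = g \<otimes> val zs then weight xs * weight zs else 0)
      = (\<Sum>xs\<in>steps m. \<Sum>zs\<in>steps m. if val xs = \<one> \<otimes> val zs then weight xs * weight zs else 0)"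
    by (intro sum.cong refl) (simp add: val_closed)
  moreover have "(\<Sum>xs\<in>steps m. \<Sum>zs\<in>steps m. if val xs = val zs then weight xs * weight zs else 0)
      = (\<Sum>xs\<in>steps m. \<Sum>zs\<in>steps m. if val xs = \<one> \<otimes> val zs then weight xs * weight zs else 0)"
    by (intro sum.cong refl) (simp add: val_closed)
  ultimately show ?thesis
    using two_coincidences_le[OF finite_walks[of m], where t = val and t' = "\<lambda>zs. g \<otimes> val zs"
        and \<omega> = weight]
    by (simp add: walk_mass_double assms)
qed

text \<open>With \<open>P\<close> the convolution operator of the walk, this is \<open>\<langle>P\<^sup>m 1\<^sub>K, 1\<^sub>K\<rangle>\<close>, the mass of the walks
  with \<open>m\<close> steps that start and end in \<open>K\<close>.\<close>

definition mass_within :: "'a set \<Rightarrow> nat \<Rightarrow> real" where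
  "mass_within K m = (\<Sum>x\<in>K. \<Sum>z\<in>K. walk_mass m (inv x \<otimes> z))"

lemma mass_within_nonneg: "0 \<le> mass_within K m"
  unfolding mass_within_def by (intro sum_nonneg walk_mass_nonneg)

lemma mass_within_eq:
  assumes "finite K" "K \<subseteq> carrier G"
  shows "mass_within K m = (\<Sum>(x, xs) | (x, xs) \<in> K \<times> steps m \<and> x \<otimes> val xs \<in> K. weight xs)"
proof -
  have iff: "val xs = inv x \<otimes> z \<longleftrightarrow> z = x \<otimes> val xs"
    if "x \<in> K" "z \<in> K" "xs \<in> steps m" for x z xs
    using that assms val_closed by (intro inv_solve_left) auto
  have "mass_within K m = (\<Sum>x\<in>K. \<Sum>z\<in>K. \<Sum>xs\<in>steps m. if z = x \<otimes> val xs then weight xs else 0)"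
    unfolding mass_within_def walk_mass_def
    unfolding sum.inter_filter[OF finite_walks] by (intro sum.cong refl) (simp add: iff)
  also have "\<dots> = (\<Sum>x\<in>K. \<Sum>xs\<in>steps m. \<Sum>z\<in>K. if z = x \<otimes> val xs then weight xs else 0)"
    by (intro sum.cong refl sum.swap)
  also have "\<dots> = (\<Sum>x\<in>K. \<Sum>xs\<in>steps m. if x \<otimes> val xs \<in> K then weight xs else 0)"
    using assms by simp
  also have "\<dots> = (\<Sum>(x, xs) | (x, xs) \<in> K \<times> steps m \<and> x \<otimes> val xs \<in> K. weight xs)"
    by (rule sum_pairs_filter[symmetric, OF assms(1) finite_walks])
  finally show ?thesis .
qed

text \<open>This is \<open>\<langle>P\<^sup>m 1\<^sub>K, 1\<^sub>K\<rangle>\<^sup>2 \<le> \<parallel>1\<^sub>K\<parallel>\<^sup>2 \<parallel>P\<^sup>m 1\<^sub>K\<parallel>\<^sup>2\<close>: as \<open>P\<close> is self-adjoint, the last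
  factor is \<open>\<langle>P\<^sup>2\<^sup>m 1\<^sub>K, 1\<^sub>K\<rangle>\<close>, which is the mass of coincidences of endpoints of two walks that
  start in \<open>K\<close>.\<close>

lemma mass_within_double:
  assumes "finite K" "K \<subseteq> carrier G"
  shows "(mass_within K m)\<^sup>2 \<le> real (card K) * mass_within K (2 * m)"
proof -
  define J where "J = K \<times> steps m"
  define t where "t = (\<lambda>(x, xs). x \<otimes> val xs)"
  define W where "W = (\<lambda>(x :: 'a, xs). weight xs)"
  have "finite J"
    using assms finite_walks by (simp add: J_def)
  have iff: "x \<otimes> val xs = z \<otimes> val zs \<longleftrightarrow> val xs = (inv x \<otimes> z) \<otimes> val zs"
    if "x \<in> K" "z \<in> K" "xs \<in> steps m" "zs \<in> steps m" for x z xs zs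
  proof -
    have c: "x \<in> carrier G" "z \<in> carrier G" "val xs \<in> carrier G" "val zs \<in> carrier G"
      using that assms val_closed by auto
    have "val xs = inv x \<otimes> (z \<otimes> val zs) \<longleftrightarrow> z \<otimes> val zs = x \<otimes> val xs"
      by (rule inv_solve_left) (use c in auto)
    moreover have "inv x \<otimes> (z \<otimes> val zs) = (inv x \<otimes> z) \<otimes> val zs"
      using c by (simp add: m_assoc)
    ultimately show ?thesis by metis
  qed
  have "(\<Sum>i\<in>J. \<Sum>j\<in>J. if t i = t j then W i * W j else 0)
      = (\<Sum>x\<in>K. \<Sum>xs\<in>steps m. \<Sum>z\<in>K. \<Sum>zs\<in>steps m.
          if x \<otimes> val xs = z \<otimes> val zs then weight xs * weight zs else 0)"
    by (simp add: J_def t_def W_def sum.cartesian_product' cong: if_cong)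
  also have "\<dots> = (\<Sum>x\<in>K. \<Sum>z\<in>K. \<Sum>xs\<in>steps m. \<Sum>zs\<in>steps m.
          if x \<otimes> val xs = z \<otimes> val zs then weight xs * weight zs else 0)"
    by (intro sum.cong refl sum.swap)
  also have "\<dots> = (\<Sum>x\<in>K. \<Sum>z\<in>K. \<Sum>xs\<in>steps m. \<Sum>zs\<in>steps m.
          if val xs = (inv x \<otimes> z) \<otimes> val zs then weight xs * weight zs else 0)"
    by (intro sum.cong refl) (simp add: iff)
  also have "\<dots> = mass_within K (2 * m)"
    unfolding mass_within_def
    by (intro sum.cong refl walk_mass_double[symmetric]) (use assms in auto)
  finally have coinc: "(\<Sum>i\<in>J. \<Sum>j\<in>J. if t i = t j then W i * W j else 0) = mass_within K (2 * m)" .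
  have "mass_within K m = (\<Sum>i | i \<in> J \<and> t i \<in> K. W i)"
    unfolding mass_within_eq[OF assms] J_def t_def W_def
    by (intro sum.cong) auto
  then show ?thesis
    using coincidences_ge[OF \<open>finite J\<close> assms(1), where t = t and \<omega> = W] coinc by simp
qed

lemma mass_within_power:
  assumes "finite K" "K \<subseteq> carrier G" "K \<noteq> {}"
  shows "(mass_within K 1 / real (card K)) ^ (2 ^ j) \<le> mass_within K (2 ^ j) / real (card K)"
proof (induction j)
  case (Suc j)
  have c: "real (card K) > 0"
    using assms by (simp add: card_gt_0_iff)
  have "(mass_within K 1 / real (card K)) ^ (2 ^ Suc j)
      = ((mass_within K 1 / real (card K)) ^ (2 ^ j))\<^sup>2"
    by (simp add: mult.commute flip: power_mult)
  also have "\<dots> \<le> (mass_within K (2 ^ j) / real (card K))\<^sup>2"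
    using Suc mass_within_nonneg by (intro power_mono) auto
  also have "\<dots> \<le> mass_within K (2 ^ Suc j) / real (card K)"
    using mass_within_double[OF assms(1,2), of "2 ^ j"] c
    by (simp add: field_simps power2_eq_square)
  finally show ?case .
qed simp

text \<open>The quadratic form at \<open>1\<^sub>K\<close> is a sum of \<open>|K|\<^sup>2\<close> values of the convolution power, each at most
  its value at the identity. One-step information thus bounds the return mass from below at the
  cost of a factor that does not depend on the length.\<close>

lemma return_mass_ge:
  assumes "finite K" "K \<subseteq> carrier G" "K \<noteq> {}"
  shows "(mass_within K 1 / real (card K)) ^ (2 ^ Suc j) / real (card K)
    \<le> walk_mass (2 ^ Suc j) \<one>"
proof -
  have c: "real (card K) > 0"
    using assms by (simp add: card_gt_0_iff)
  have "mass_within K (2 ^ Suc j) \<le> (\<Sum>x\<in>K. \<Sum>z\<in>K. walk_mass (2 ^ Suc j) \<one>)"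
    unfolding mass_within_def using assms(2)
    by (intro sum_mono) (auto intro!: walk_mass_le_return)
  also have "\<dots> = (real (card K))\<^sup>2 * walk_mass (2 ^ Suc j) \<one>"
    by (simp add: power2_eq_square)
  finally have "mass_within K (2 ^ Suc j) / (real (card K))\<^sup>2 \<le> walk_mass (2 ^ Suc j) \<one>"
    using c by (simp add: field_simps)
  moreover have "(mass_within K 1 / real (card K)) ^ (2 ^ Suc j) / real (card K)
      \<le> mass_within K (2 ^ Suc j) / (real (card K))\<^sup>2"
    using divide_right_mono[OF mass_within_power[OF assms, of "Suc j"], of "real (card K)"]
    by (simp add: power2_eq_square)
  ultimately show ?thesis by linarith
qed

lemma mass_within_one:
  assumes "finite K" "K \<subseteq> carrier G"
  shows "mass_within K 1 = (\<Sum>e\<in>E. \<omega> e * real (card {x \<in> K. x \<otimes> s e \<in> K}))"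
proof -
  have "mass_within K 1 = (\<Sum>(x, e) | (x, e) \<in> K \<times> E \<and> x \<otimes> s e \<in> K. \<omega> e)"
    unfolding mass_within_eq[OF assms]
    by (rule sum.reindex_bij_witness[where i = "\<lambda>(x, e). (x, [e])" and j = "\<lambda>(x, xs). (x, hd xs)"])
       (auto simp: steps_def length_Suc_conv weight_def step_closed)
  also have "\<dots> = (\<Sum>x\<in>K. \<Sum>e\<in>E. if x \<otimes> s e \<in> K then \<omega> e else 0)"
    by (rule sum_pairs_filter[OF assms(1) finite_steps])
  also have "\<dots> = (\<Sum>e\<in>E. \<Sum>x\<in>K. if x \<otimes> s e \<in> K then \<omega> e else 0)"
    by (rule sum.swap)
  also have "\<dots> = (\<Sum>e\<in>E. \<omega> e * real (card {x \<in> K. x \<otimes> s e \<in> K}))"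
    using assms(1) by (intro sum.cong refl) (simp flip: sum.inter_filter)
  finally show ?thesis .
qed

end

text \<open>The sets in the definition of amenability are almost invariant under left translation; their
  images under inversion are almost invariant under right translation, which is what a walk that
  multiplies its steps on the right needs. Keeping half of the set is enough here: the resulting
  loss of a factor 2 per block of length \<open>N\<close> disappears in the exponential growth rate as
  \<open>N\<close> grows.\<close>

lemma (in group) amenable_almost_invariant_set:
  assumes "amenable G" and "finite S" "S \<subseteq> carrier G"
  obtains K where "finite K" "K \<noteq> {}" "K \<subseteq> carrier G"
    "\<And>g. g \<in> S \<Longrightarrow> real (card K) \<le> 2 * real (card {x \<in> K. x \<otimes> g \<in> K})"
proof -
  obtain F :: "nat \<Rightarrow> 'a set"
    where F: "\<And>n. finite (F n)" "\<And>n. F n \<noteq> {}" "\<And>n. F n \<subseteq> carrier G"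
      and lim: "\<And>g. g \<in> carrier G \<Longrightarrow>
        (\<lambda>n. real (card (sym_diff (g <#\<^bsub>G\<^esub> F n) (F n))) / real (card (F n))) \<longlonglongrightarrow> 0"
    using assms(1) unfolding amenable_def by (elim exE) blast
  have "\<forall>\<^sub>F n in sequentially. \<forall>g\<in>S.
      real (card (sym_diff (g <#\<^bsub>G\<^esub> F n) (F n))) / real (card (F n)) < 1 / 2"
  proof (rule eventually_ball_finite[OF assms(2)])
    show "\<forall>g\<in>S. \<forall>\<^sub>F n in sequentially.
        real (card (sym_diff (g <#\<^bsub>G\<^esub> F n) (F n))) / real (card (F n)) < 1 / 2"
      using assms(3) by (intro ballI order_tendstoD(2)[OF lim]) auto
  qed
  then obtain n where n: "\<And>g. g \<in> S \<Longrightarrow>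
      real (card (sym_diff (g <#\<^bsub>G\<^esub> F n) (F n))) / real (card (F n)) < 1 / 2"
    by (auto simp: eventually_sequentially)
  \<comment> \<open>Inversion turns left into right translation.\<close>
  define K where "K = m_inv G ` F n"
  have inj: "inj_on (m_inv G) (F n)"
    using F(3) by (intro inj_on_subset[OF inv_inj])
  have cardK: "card K = card (F n)"
    unfolding K_def by (rule card_image[OF inj])
  show thesis
  proof
    show "finite K" "K \<noteq> {}" "K \<subseteq> carrier G"
      using F[of n] by (auto simp: K_def)
  next
    fix g assume g: "g \<in> S"
    then have gG: "g \<in> carrier G"
      using assms(3) by auto
    have fin: "finite (g <#\<^bsub>G\<^esub> F n)"
      using F(1) by (simp add: l_coset_def)
    have "m_inv G ` (F n \<inter> (g <#\<^bsub>G\<^esub> F n)) \<subseteq> {x \<in> K. x \<otimes> g \<in> K}"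
    proof clarify
      fix y assume y: "y \<in> F n" "y \<in> g <#\<^bsub>G\<^esub> F n"
      then obtain z where z: "z \<in> F n" "y = g \<otimes> z"
        by (auto simp: l_coset_def)
      have "z \<in> carrier G" "y \<in> carrier G"
        using y z F(3)[of n] by auto
      then have "inv y \<otimes> g = inv z"
        using z(2) gG by (simp add: inv_mult_group m_assoc)
      then show "inv y \<in> K \<and> inv y \<otimes> g \<in> K"
        using y(1) z(1) by (auto simp: K_def)
    qed
    moreover have "finite {x \<in> K. x \<otimes> g \<in> K}"
      using F(1) by (simp add: K_def)
    ultimately have "card (F n \<inter> (g <#\<^bsub>G\<^esub> F n)) \<le> card {x \<in> K. x \<otimes> g \<in> K}"
      using card_image[OF inj_on_subset[OF inj, of "F n \<inter> (g <#\<^bsub>G\<^esub> F n)"]]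
      by (metis Int_lower1 card_mono)
    moreover have "card (F n) \<le> card (F n \<inter> (g <#\<^bsub>G\<^esub> F n)) + card (sym_diff (g <#\<^bsub>G\<^esub> F n) (F n))"
    proof -
      have "F n \<subseteq> (F n \<inter> (g <#\<^bsub>G\<^esub> F n)) \<union> sym_diff (g <#\<^bsub>G\<^esub> F n) (F n)"
        by auto
      then have "card (F n) \<le> card ((F n \<inter> (g <#\<^bsub>G\<^esub> F n)) \<union> sym_diff (g <#\<^bsub>G\<^esub> F n) (F n))"
        using F(1) fin by (intro card_mono) auto
      then show ?thesis
        using card_Un_le order_trans by blast
    qed
    moreover have "real (card (sym_diff (g <#\<^bsub>G\<^esub> F n) (F n))) < real (card (F n)) / 2"
      using n[OF g] F(1,2)[of n] by (simp add: field_simps card_gt_0_iff split: if_splits)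
    ultimately show "real (card K) \<le> 2 * real (card {x \<in> K. x \<otimes> g \<in> K})"
      using cardK by linarith
  qed
qed

text \<open>If \<open>K\<close> is almost invariant under all steps, at least half of the one-step mass starting in
  \<open>K\<close> stays in \<open>K\<close>.\<close>

theorem (in symmetric_walk) amenable_return_mass:
  assumes "amenable G"
  obtains \<kappa> where "\<kappa> > 0"
    "\<And>j. \<kappa> * ((\<Sum>e\<in>E. \<omega> e) / 2) ^ (2 ^ Suc j) \<le> walk_mass (2 ^ Suc j) \<one>"
proof -
  obtain K where K: "finite K" "K \<noteq> {}" "K \<subseteq> carrier G"
    and inv: "\<And>g. g \<in> s ` E \<Longrightarrow> real (card K) \<le> 2 * real (card {x \<in> K. x \<otimes> g \<in> K})"
    using amenable_almost_invariant_set[OF assms, of "s ` E"] finite_steps step_closed by blast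
  have c: "real (card K) > 0"
    using K by (simp add: card_gt_0_iff)
  have "(\<Sum>e\<in>E. \<omega> e) * real (card K) = (\<Sum>e\<in>E. \<omega> e * real (card K))"
    by (simp add: sum_distrib_right)
  also have "\<dots> \<le> (\<Sum>e\<in>E. \<omega> e * (2 * real (card {x \<in> K. x \<otimes> s e \<in> K})))"
    by (intro sum_mono mult_left_mono inv weight_nonneg) auto
  also have "\<dots> = 2 * mass_within K 1"
    unfolding mass_within_one[OF K(1,3)] by (simp add: sum_distrib_left mult_ac)
  finally have le: "(\<Sum>e\<in>E. \<omega> e) / 2 \<le> mass_within K 1 / real (card K)"
    using c by (simp add: field_simps)
  show thesis
  proof
    show "1 / real (card K) > 0"
      using c by simp
  next
    fix j
    have "((\<Sum>e\<in>E. \<omega> e) / 2) ^ (2 ^ Suc j) \<le> (mass_within K 1 / real (card K)) ^ (2 ^ Suc j)"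
      using le by (intro power_mono divide_nonneg_pos sum_nonneg weight_nonneg) auto
    then have "((\<Sum>e\<in>E. \<omega> e) / 2) ^ (2 ^ Suc j) / real (card K)
        \<le> (mass_within K 1 / real (card K)) ^ (2 ^ Suc j) / real (card K)"
      by (intro divide_right_mono) auto
    then show "1 / real (card K) * ((\<Sum>e\<in>E. \<omega> e) / 2) ^ (2 ^ Suc j) \<le> walk_mass (2 ^ Suc j) \<one>"
      using return_mass_ge[OF K(1,3,2), of j] by simp
  qed
qed

section \<open>Words, periodic points and distortion\<close>

lemma shift_funpow: "(shift ^^ n) x = (\<lambda>k. x (k + n))"
  by (induction n) (auto simp: shift_def)

lemma orbit_prod_add:
  "orbit_prod T \<phi> (m + n) x = orbit_prod T \<phi> m x * orbit_prod T \<phi> n ((T ^^ m) x)"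
proof -
  have "orbit_prod T \<phi> (m + n) x = orbit_prod T \<phi> m x * (\<Prod>k = m..<m + n. \<phi> ((T ^^ k) x))"
    unfolding orbit_prod_def by (simp add: lessThan_atLeast0 prod.atLeastLessThan_concat)
  also have "(\<Prod>k = m..<m + n. \<phi> ((T ^^ k) x)) = (\<Prod>k<n. \<phi> ((T ^^ (k + m)) x))"
    using prod.shift_bounds_nat_ivl[of "\<lambda>k. \<phi> ((T ^^ k) x)" 0 m n]
    by (simp add: lessThan_atLeast0 add.commute)
  finally show ?thesis
    by (simp add: orbit_prod_def funpow_add)
qed

text \<open>The factors along one period are permuted cyclically.\<close>

lemma orbit_prod_rotate:
  assumes "(T ^^ n) x = x"
  shows "orbit_prod T \<phi> n (T x) = orbit_prod T \<phi> n x"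
proof (cases n)
  case (Suc m)
  have "orbit_prod T \<phi> n x = orbit_prod T \<phi> 1 x * orbit_prod T \<phi> m (T x)"
    using orbit_prod_add[of T \<phi> 1 m x] Suc by simp
  also have "orbit_prod T \<phi> 1 x = orbit_prod T \<phi> 1 ((T ^^ m) (T x))"
    using assms Suc by (simp add: orbit_prod_def funpow_swap1)
  also have "\<dots> * orbit_prod T \<phi> m (T x) = orbit_prod T \<phi> n (T x)"
    using orbit_prod_add[of T \<phi> m 1 "T x"] Suc by simp
  finally show ?thesis by simp
qed (simp add: orbit_prod_def)

text \<open>In \<open>xs @ [b]\<close> the last entry \<open>b\<close> names the entry that has to come next, so it is replaced
  and not repeated.\<close>

lemma successively_glue:
  assumes "successively P (xs @ [b])" "successively P (ys @ zs)" "hd (ys @ zs) = b" "ys @ zs \<noteq> []"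
  shows "successively P (xs @ ys @ zs)"
  using assms by (induction xs) (auto simp: successively_Cons hd_append split: if_splits)

text \<open>The function \<open>D\<close> bounds the distortion between a cylinder and its mirror image at each length
  separately; its growth enters only when \<open>n\<close> tends to infinity.\<close>

locale symmetric_chain = group G for G (structure) +
  fixes I :: "'i set" and A :: "'i \<Rightarrow> 'i \<Rightarrow> nat"
    and \<psi> :: "(nat \<Rightarrow> 'i) \<Rightarrow> 'a" and \<phi> :: "(nat \<Rightarrow> 'i) \<Rightarrow> real" and dag :: "'i \<Rightarrow> 'i"
    and D :: "nat \<Rightarrow> real"
  assumes matrix: "transition_matrix I A"
    and \<psi>_closed: "\<psi> \<in> markov_space I A \<rightarrow> carrier G"
    and \<psi>_constant: "constant_on_letters I A \<psi>"
    and symmetric: "symmetric_extension I A G \<psi> dag"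
    and \<phi>_pos: "x \<in> markov_space I A \<Longrightarrow> 0 < \<phi> x"
    and distortion: "\<lbrakk>w \<in> words I A n; x \<in> cylinder I A w; y \<in> cylinder I A (word_dag dag w)\<rbrakk>
      \<Longrightarrow> orbit_prod shift \<phi> n x / orbit_prod shift \<phi> n y \<le> D n"
begin

definition admissible :: "'i list \<Rightarrow> bool" where
  "admissible w \<longleftrightarrow> set w \<subseteq> I \<and> successively (\<lambda>i j. A i j = 1) w"

text \<open>The target \<open>b\<close> is not part of the word, so that paths compose by concatenation of words; the
  empty word is a path from \<open>a\<close> to \<open>a\<close>.\<close>

definition chain_path :: "'i \<Rightarrow> 'i list \<Rightarrow> 'i \<Rightarrow> bool" where
  "chain_path a w b \<longleftrightarrow> admissible (w @ [b]) \<and> hd (w @ [b]) = a"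

abbreviation \<Phi> :: "nat \<Rightarrow> (nat \<Rightarrow> 'i) \<Rightarrow> real" where
  "\<Phi> \<equiv> orbit_prod shift \<phi>"

abbreviation \<l> :: "'i \<Rightarrow> 'a" where
  "\<l> \<equiv> letter_value I A \<psi>"

abbreviation \<psi>w :: "'i list \<Rightarrow> 'a" where
  "\<psi>w \<equiv> word_value G \<l>"

lemma words_iff: "w \<in> words I A n \<longleftrightarrow> w \<noteq> [] \<and> length w = n \<and> admissible w"
  by (auto simp: words_def admissible_def successively_conv_nth)

lemma chain_path_append: "chain_path a w b \<Longrightarrow> chain_path b w' c \<Longrightarrow> chain_path a (w @ w') c"
  using successively_glue[of "\<lambda>i j. A i j = 1" w b w' "[c]"]
  by (auto simp: chain_path_def admissible_def hd_append)

lemma chain_pathD: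
  assumes "chain_path a w b"
  shows "admissible w" "a \<in> I" "b \<in> I"
proof -
  have "a \<in> set (w @ [b])"
    using assms by (metis chain_path_def hd_in_set snoc_eq_iff_butlast)
  then show "admissible w" "a \<in> I" "b \<in> I"
    using assms by (auto simp: chain_path_def admissible_def successively_append_iff)
qed

lemma dag_in: "i \<in> I \<Longrightarrow> dag i \<in> I"
  and dag_dag: "i \<in> I \<Longrightarrow> dag (dag i) = i"
  and letter_dag: "i \<in> I \<Longrightarrow> \<l> (dag i) = inv (\<l> i)"
  using symmetric by (auto simp: symmetric_extension_def)

lemma edge_dag:
  assumes "i \<in> I" "j \<in> I" "A i j = 1"
  shows "A (dag j) (dag i) = 1"
proof -
  have "[i, j] \<in> words I A 2"
    using assms by (simp add: words_iff admissible_def)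
  then have "[dag j, dag i] \<in> words I A 2"
    using symmetric assms(1,2) unfolding symmetric_extension_def by blast
  then show ?thesis
    by (simp add: words_iff admissible_def)
qed

lemma admissible_dag:
  assumes "admissible w"
  shows "admissible (word_dag dag w)"
proof -
  have "successively (\<lambda>i j. A (dag j) (dag i) = 1) w"
    using assms edge_dag unfolding admissible_def
    by (auto elim!: successively_mono)
  then show ?thesis
    using assms dag_in by (auto simp: admissible_def word_dag_def successively_map)
qed

lemma word_dag_word_dag: "set w \<subseteq> I \<Longrightarrow> word_dag dag (word_dag dag w) = w"
  by (auto simp: word_dag_def rev_map dag_dag intro!: map_idI)

text \<open>Every row of the matrix has a positive entry, so a word can be continued forever.\<close>

lemma cylinder_nonempty:
  assumes "admissible w" "w \<noteq> []"
  shows "\<exists>x. x \<in> cylinder I A w"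
proof -
  have "\<forall>i\<in>I. \<exists>j. j \<in> I \<and> A i j = 1"
  proof
    fix i assume i: "i \<in> I"
    then obtain j where "j \<in> I" "A i j > 0"
      using matrix by (auto simp: transition_matrix_def)
    moreover from this have "A i j \<in> {0, 1}"
      using matrix i unfolding transition_matrix_def by blast
    ultimately show "\<exists>j. j \<in> I \<and> A i j = 1"
      by auto
  qed
  then obtain f where f: "\<And>i. i \<in> I \<Longrightarrow> f i \<in> I \<and> A i (f i) = 1"
    by metis
  define x where "x k = (if k < length w then w ! k else (f ^^ (Suc k - length w)) (last w))" for k
  have last: "last w \<in> I" "set w \<subseteq> I"
    using assms by (auto simp: admissible_def)
  have iter: "(f ^^ n) (last w) \<in> I" for n
    by (induction n) (use last f in auto)
  have "x k \<in> I" for k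
    using last iter by (auto simp: x_def)
  moreover have "A (x k) (x (Suc k)) = 1" for k
  proof -
    consider "Suc k < length w" | "Suc k = length w" | "length w \<le> k"
      by linarith
    then show ?thesis
    proof cases
      case 1
      then show ?thesis
        using assms by (auto simp: x_def admissible_def successively_conv_nth)
    next
      case 2
      then have "w ! k = last w"
        using assms(2) by (metis diff_Suc_1 last_conv_nth)
      then show ?thesis
        using 2 f[OF last(1)] by (simp add: x_def flip: 2)
    next
      case 3
      then show ?thesis
        using f[OF iter[of "Suc k - length w"]] by (simp add: x_def Suc_diff_le)
    qed
  qed
  ultimately have "x \<in> cylinder I A w"
    by (simp add: cylinder_def markov_space_def x_def)
  then show ?thesis by blast
qed

lemma shift_funpow_in_space: "x \<in> markov_space I A \<Longrightarrow> (shift ^^ n) x \<in> markov_space I A"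
  by (simp add: shift_funpow markov_space_def)

lemma \<Phi>_pos: "x \<in> markov_space I A \<Longrightarrow> 0 < \<Phi> n x"
  unfolding orbit_prod_def by (intro prod_pos ballI \<phi>_pos shift_funpow_in_space)

lemma cylinder_in_space: "x \<in> cylinder I A w \<Longrightarrow> x \<in> markov_space I A"
  by (simp add: cylinder_def)

lemma letter_value_eq:
  assumes "x \<in> markov_space I A"
  shows "\<psi> x = \<l> (x 0)"
proof -
  have x: "x \<in> cylinder I A [x 0]" "x 0 \<in> I"
    using assms by (auto simp: cylinder_def markov_space_def)
  then have "\<psi> ` cylinder I A [x 0] = {\<psi> x}"
    using \<psi>_constant unfolding constant_on_letters_def by blast
  then show ?thesis
    by (simp add: letter_value_def)
qed

lemma letter_closed:
  assumes "i \<in> I"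
  shows "\<l> i \<in> carrier G"
proof -
  obtain x where x: "x \<in> cylinder I A [i]"
    using cylinder_nonempty[of "[i]"] assms by (auto simp: admissible_def)
  have "\<psi> x \<in> carrier G"
    using \<psi>_closed cylinder_in_space[OF x] by (rule funcset_mem)
  moreover have "x 0 = i"
    using x by (simp add: cylinder_def)
  ultimately show ?thesis
    using letter_value_eq[OF cylinder_in_space[OF x]] by simp
qed

lemma \<psi>w_closed: "set w \<subseteq> I \<Longrightarrow> \<psi>w w \<in> carrier G"
  by (intro word_value_closed) (auto intro: letter_closed)

lemma \<psi>w_append: "set w \<subseteq> I \<Longrightarrow> set w' \<subseteq> I \<Longrightarrow> \<psi>w (w @ w') = \<psi>w w \<otimes> \<psi>w w'"
  by (intro word_value_append) (auto intro: letter_closed)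

lemma \<psi>w_dag: "set w \<subseteq> I \<Longrightarrow> \<psi>w (word_dag dag w) = inv (\<psi>w w)"
  unfolding word_dag_def by (intro word_value_rev_inverse) (auto intro: letter_closed letter_dag)

lemma extension_map_funpow:
  assumes "x \<in> markov_space I A" "g \<in> carrier G"
  shows "(extension_map G \<psi> ^^ n) (x, g) = ((shift ^^ n) x, g \<otimes> \<psi>w (map x [0..<n]))"
proof (induction n)
  case (Suc n)
  have I: "x k \<in> I" for k
    using assms(1) by (simp add: markov_space_def)
  then have c: "\<psi>w (map x [0..<n]) \<in> carrier G" "\<l> (x n) \<in> carrier G"
    by (auto intro!: \<psi>w_closed letter_closed)
  have "\<psi> ((shift ^^ n) x) = \<l> (x n)"
    using letter_value_eq[OF shift_funpow_in_space[OF assms(1), of n]] by (simp add: shift_funpow)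
  moreover have "\<psi>w (map x [0..<Suc n]) = \<psi>w (map x [0..<n]) \<otimes> \<l> (x n)"
    using I c by (simp add: \<psi>w_append image_subset_iff)
  ultimately show ?case
    using Suc c assms(2) by (simp add: extension_map_def m_assoc)
qed (use assms in simp)

lemma orbit_prod_extension:
  "orbit_prod (extension_map G \<psi>) (\<lambda>(x, g). \<phi> x) n (x, g) = \<Phi> n x"
proof -
  have "fst ((extension_map G \<psi> ^^ k) (x, g)) = (shift ^^ k) x" for k
    by (induction k) (auto simp: extension_map_def split: prod.splits)
  then show ?thesis
    by (simp add: orbit_prod_def case_prod_beta)
qed

text \<open>Only used for nonempty words that close up, so that \<open>k mod length w\<close> is a valid position.\<close>

definition periodic_point :: "'i list \<Rightarrow> nat \<Rightarrow> 'i" where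
  "periodic_point w k = w ! (k mod length w)"

lemma periodic_point:
  assumes "chain_path a w a" "w \<noteq> []"
  shows "periodic_point w \<in> cylinder I A w" "periodic_point w 0 = a"
    "(shift ^^ length w) (periodic_point w) = periodic_point w"
    "map (periodic_point w) [0..<length w] = w"
proof -
  have w: "set w \<subseteq> I" "hd w = a" "successively (\<lambda>i j. A i j = 1) w" "A (last w) a = 1"
    using assms by (auto simp: chain_path_def admissible_def successively_append_iff)
  have "A (periodic_point w k) (periodic_point w (Suc k)) = 1" for k
  proof (cases "Suc (k mod length w) < length w")
    case True
    then show ?thesis
      using w(3) by (simp add: periodic_point_def mod_Suc successively_conv_nth)
  next
    case False
    then have "Suc (k mod length w) = length w"
      using assms(2) by (metis Suc_lessI length_greater_0_conv mod_less_divisor)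
    then have "k mod length w = length w - 1" "Suc k mod length w = 0"
      by (auto simp: mod_Suc)
    then show ?thesis
      using w(2,4) assms(2) by (simp add: periodic_point_def last_conv_nth hd_conv_nth)
  qed
  then show "periodic_point w \<in> cylinder I A w"
    using w(1) assms(2) by (auto simp: cylinder_def markov_space_def periodic_point_def)
  show "periodic_point w 0 = a"
    using w(2) assms(2) by (simp add: periodic_point_def hd_conv_nth)
  show "(shift ^^ length w) (periodic_point w) = periodic_point w"
    by (simp add: shift_funpow periodic_point_def fun_eq_iff)
  show "map (periodic_point w) [0..<length w] = w"
    by (rule nth_equalityI) (auto simp: periodic_point_def)
qed

text \<open>The sign condition lets bounds for factors of a word be multiplied.\<close>

definition cylinder_bound :: "'i list \<Rightarrow> real \<Rightarrow> bool" where
  "cylinder_bound w c \<longleftrightarrow> 0 \<le> c \<and> (\<forall>x\<in>cylinder I A w. c \<le> \<Phi> (length w) x)"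

lemma cylinder_append:
  assumes "x \<in> cylinder I A (w @ w')"
  shows "x \<in> cylinder I A w" "(shift ^^ length w) x \<in> cylinder I A w'"
proof -
  have n: "\<And>k. k < length (w @ w') \<Longrightarrow> x k = (w @ w') ! k"
    using assms by (simp add: cylinder_def)
  show "x \<in> cylinder I A w"
    using n cylinder_in_space[OF assms] by (auto simp: cylinder_def nth_append)
  have "x (k + length w) = w' ! k" if "k < length w'" for k
    using n[of "k + length w"] that by (simp add: nth_append)
  then show "(shift ^^ length w) x \<in> cylinder I A w'"
    using shift_funpow_in_space[OF cylinder_in_space[OF assms], of "length w"]
    by (simp add: cylinder_def shift_funpow)
qed

lemma cylinder_bound_append:
  assumes "cylinder_bound w c" "cylinder_bound w' c'"
  shows "cylinder_bound (w @ w') (c * c')"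
  using assms cylinder_append unfolding cylinder_bound_def
  by (auto simp: orbit_prod_add intro!: mult_mono')

lemma cylinder_bound_concat:
  "(\<And>e. e \<in> set es \<Longrightarrow> cylinder_bound (b e) (c e)) \<Longrightarrow>
     cylinder_bound (concat (map b es)) (prod_list (map c es))"
proof (induction es)
  case (Cons e es)
  then show ?case
    by (auto intro!: cylinder_bound_append)
qed (simp add: cylinder_bound_def orbit_prod_def)

lemma distortion_pos:
  assumes "admissible w" "w \<noteq> []"
  shows "0 < D (length w)"
proof -
  obtain x where x: "x \<in> cylinder I A w"
    using cylinder_nonempty[OF assms] by blast
  obtain y where y: "y \<in> cylinder I A (word_dag dag w)"
    using cylinder_nonempty[OF admissible_dag[OF assms(1)]] assms(2) by (auto simp: word_dag_def)
  have "0 < \<Phi> (length w) x / \<Phi> (length w) y"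
    using \<Phi>_pos cylinder_in_space x y by simp
  also have "\<dots> \<le> D (length w)"
    using distortion[of w "length w" x y] x y assms by (simp add: words_iff)
  finally show ?thesis .
qed

lemma cylinder_bound_dag:
  assumes "admissible w" "w \<noteq> []" "x \<in> cylinder I A w"
  shows "cylinder_bound (word_dag dag w) (\<Phi> (length w) x / D (length w))"
proof -
  have pos: "0 < D (length w)" "0 < \<Phi> (length w) x"
    using distortion_pos assms \<Phi>_pos cylinder_in_space by auto
  have "\<Phi> (length w) x / D (length w) \<le> \<Phi> (length w) y" if "y \<in> cylinder I A (word_dag dag w)" for y
    using distortion[of w "length w" x y] that assms \<Phi>_pos[OF cylinder_in_space[OF that], of "length w"] pos
    by (simp add: words_iff field_simps)
  then show ?thesis
    using pos by (simp add: cylinder_bound_def word_dag_def)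
qed

text \<open>Weak symmetry compares a cylinder with its mirror image only. Passing to a point of the mirror
  image and back controls the variation of \<open>\<Phi>\<^sub>n\<close> within one cylinder, which costs a second factor
  \<open>D n\<close>.\<close>

lemma cylinder_bound_self:
  assumes "admissible w" "w \<noteq> []" "x \<in> cylinder I A w"
  shows "cylinder_bound w (\<Phi> (length w) x / (D (length w))\<^sup>2)"
proof -
  have w': "admissible (word_dag dag w)" "word_dag dag w \<noteq> []" "word_dag dag (word_dag dag w) = w"
    "length (word_dag dag w) = length w"
    using assms admissible_dag word_dag_word_dag by (auto simp: word_dag_def admissible_def)
  obtain z where z: "z \<in> cylinder I A (word_dag dag w)"
    using cylinder_nonempty[OF w'(1,2)] by blast
  have pos: "0 < D (length w)" "0 < \<Phi> (length w) x"
    using distortion_pos assms \<Phi>_pos cylinder_in_space by auto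
  have "\<Phi> (length w) x / D (length w) \<le> \<Phi> (length w) z"
    using cylinder_bound_dag[OF assms] z w'(4) by (simp add: cylinder_bound_def)
  then have "\<Phi> (length w) x / (D (length w))\<^sup>2 \<le> \<Phi> (length w) z / D (length w)"
    using pos by (simp add: field_simps power2_eq_square)
  moreover have "cylinder_bound w (\<Phi> (length w) z / D (length w))"
    using cylinder_bound_dag[OF w'(1,2) z] w'(3,4) by simp
  ultimately show ?thesis
    using pos by (auto simp: cylinder_bound_def intro: order_trans)
qed

lemma cylinder_bound_exists:
  assumes "admissible w" "w \<noteq> []"
  obtains c where "0 < c" "cylinder_bound w c"
proof -
  obtain x where x: "x \<in> cylinder I A w"
    using cylinder_nonempty[OF assms] by blast
  show thesis
    using that[OF _ cylinder_bound_self[OF assms x]] distortion_pos[OF assms]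
      \<Phi>_pos[OF cylinder_in_space[OF x]] by simp
qed

text \<open>The second coordinate of a path in the extension records the partial products of \<open>\<psi>\<close>.\<close>

lemma extension_path:
  assumes "set (W @ [(b, h)]) \<subseteq> I \<times> carrier G"
    and "successively (\<lambda>p q. extension_matrix I A G \<psi> p q = 1) (W @ [(b, h)])"
  shows "snd (hd (W @ [(b, h)])) \<otimes> \<psi>w (map fst W) = h"
    and "successively (\<lambda>i j. A i j = 1) (map fst W @ [b])"
proof -
  have "snd (hd (W @ [(b, h)])) \<otimes> \<psi>w (map fst W) = h
      \<and> successively (\<lambda>i j. A i j = 1) (map fst W @ [b])"
    using assms
  proof (induction W)
    case (Cons p W)
    obtain c g where p: "p = (c, g)"
      by (cases p)
    obtain d g' where d: "hd (W @ [(b, h)]) = (d, g')"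
      by (cases "hd (W @ [(b, h)])")
    have IH: "g' \<otimes> \<psi>w (map fst W) = h" "successively (\<lambda>i j. A i j = 1) (map fst W @ [b])"
      using Cons d by (auto simp: successively_Cons)
    have "extension_matrix I A G \<psi> (c, g) (d, g') = 1"
      using Cons.prems(2) d p by (auto simp: successively_Cons)
    then have e: "A c d = 1" "g' = g \<otimes> \<l> c"
      unfolding extension_matrix_def prod.case by (metis zero_neq_one)+
    have "hd (map fst W @ [b]) = d"
      using d by (cases W) auto
    then have "successively (\<lambda>i j. A i j = 1) (map fst (p # W) @ [b])"
      using IH(2) e(1) p by (auto simp: successively_Cons)
    moreover have "fst ` set W \<subseteq> I" "g \<in> carrier G" "c \<in> I"
      using Cons.prems(1) p by (auto dest!: subsetD)
    then have "\<psi>w (map fst W) \<in> carrier G" "g \<in> carrier G" "\<l> c \<in> carrier G"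
      by (simp_all add: \<psi>w_closed letter_closed)
    ultimately show ?case
      using IH(1) e(2) p by (simp add: m_assoc)
  qed auto
  then show "snd (hd (W @ [(b, h)])) \<otimes> \<psi>w (map fst W) = h"
    and "successively (\<lambda>i j. A i j = 1) (map fst W @ [b])" by auto
qed

lemma transitive_path:
  assumes "extension_transitive I A G \<psi>" "a \<in> I" "b \<in> I" "h \<in> carrier G"
  obtains w where "w \<noteq> []" "chain_path a w b" "\<psi>w w = h"
proof -
  obtain n W where W: "W \<in> words (I \<times> carrier G) (extension_matrix I A G \<psi>) n" "hd W = (a, \<one>)"
      "W @ [(b, h)] \<in> words (I \<times> carrier G) (extension_matrix I A G \<psi>) (Suc n)"
    using assms unfolding extension_transitive_def chain_transitive_def by (meson SigmaI one_closed)
  have ne: "W \<noteq> []" "length W = n"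
    using W(1) by (auto simp: words_def)
  have W': "set (W @ [(b, h)]) \<subseteq> I \<times> carrier G"
      "successively (\<lambda>p q. extension_matrix I A G \<psi> p q = 1) (W @ [(b, h)])"
    using W(3) by (auto simp: words_def successively_conv_nth)
  have I: "fst ` set W \<subseteq> I"
    using W'(1) by (auto dest!: subsetD)
  then have "\<psi>w (map fst W) = h"
    using extension_path(1)[OF W'] W(2) ne by (simp add: \<psi>w_closed)
  moreover have "chain_path a (map fst W) b"
    using extension_path(2)[OF W'] W(2) ne I assms(3)
    by (simp add: chain_path_def admissible_def hd_map)
  ultimately show thesis
    using that[of "map fst W"] ne by simp
qed

end

section \<open>Closed walks as periodic orbits of the extension\<close>

lemma infsum_ennreal_mono:
  fixes f g :: "'x \<Rightarrow> ennreal"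
  assumes "A \<subseteq> B" "\<And>x. x \<in> A \<Longrightarrow> f x \<le> g x"
  shows "infsum f A \<le> infsum g B"
  using assms by (intro infsum_mono_neutral) (auto intro: nonneg_summable_on_complete)

context symmetric_chain
begin

definition fixed_points :: "'i \<Rightarrow> nat \<Rightarrow> (nat \<Rightarrow> 'i) set" where
  "fixed_points a n = {x \<in> cylinder I A [a]. (shift ^^ n) x = x}"

abbreviation prefix :: "nat \<Rightarrow> (nat \<Rightarrow> 'i) \<Rightarrow> 'i list" where
  "prefix n x \<equiv> map x [0..<n]"

lemma admissible_segment:
  "x \<in> markov_space I A \<Longrightarrow> admissible (map x [m..<n])"
  by (auto simp: admissible_def markov_space_def successively_conv_nth)

lemma fixed_point_prefix:
  assumes "x \<in> fixed_points a n" "0 < n"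
  shows "x \<in> markov_space I A" "x 0 = a" "x n = a" "a \<in> I" "chain_path a (prefix n x) a"
    "x \<in> cylinder I A (prefix n x)"
proof -
  have x: "x \<in> markov_space I A" "x 0 = a" "(shift ^^ n) x = x"
    using assms by (auto simp: fixed_points_def cylinder_def)
  have "x n = (shift ^^ n) x 0"
    by (simp add: shift_funpow)
  then have n: "x n = a"
    using x by simp
  have "prefix n x @ [a] = prefix (Suc n) x"
    using n by simp
  moreover have "hd (prefix (Suc n) x) = a"
    using x(2) by (simp add: hd_map del: upt_Suc)
  ultimately show "chain_path a (prefix n x) a"
    unfolding chain_path_def using admissible_segment[OF x(1), of 0 "Suc n"] by simp
  show "x \<in> markov_space I A" "x 0 = a" "x n = a" "a \<in> I"
    using x n by (auto simp: markov_space_def)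
  show "x \<in> cylinder I A (prefix n x)"
    using x by (simp add: cylinder_def)
qed

lemma fixed_point_eqI:
  assumes "x \<in> fixed_points a n" "y \<in> fixed_points a n" "0 < n" "prefix n x = prefix n y"
  shows "x = y"
proof -
  have mod: "z k = z (k mod n)" if "z \<in> fixed_points a n" for z k
  proof -
    have per: "z (k + n) = z k" for k
      using that by (simp add: fixed_points_def shift_funpow fun_eq_iff)
    have "z (k mod n + n * j) = z (k mod n)" for j
      using per[of "k mod n + n * (j - 1)" for j]
      by (induction j) (simp, metis add.assoc mult_Suc_right add.commute per)
    from this[of "k div n"] show ?thesis by simp
  qed
  have "x k = y k" if "k < n" for k
    using assms(4) that by simp
  then show ?thesis
    using mod[OF assms(1)] mod[OF assms(2)] assms(3) by (metis ext mod_less_divisor)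
qed

text \<open>The mirror image of \<open>x\<^sub>0 \<dots> x\<^sub>n\<^sub>-\<^sub>1\<close> begins with \<open>(x\<^sub>n\<^sub>-\<^sub>1)\<^sup>\<dagger>\<close>, a letter that varies with
  \<open>x\<close>. Mirroring the rotated word \<open>x\<^sub>1 \<dots> x\<^sub>n\<close>, whose last letter is \<open>a\<close>, gives instead a
  closed path at \<open>a\<^sup>\<dagger>\<close>. The price is that the value is the inverse only up to conjugation by the
  value of \<open>a\<close>; the weight is unaffected, since \<open>\<Phi>\<^sub>n\<close> is invariant along a periodic orbit.\<close>

lemma return_path:
  assumes "x \<in> fixed_points a n" "0 < n"
  defines "w \<equiv> word_dag dag (map x [1..<Suc n])"
  shows "chain_path (dag a) w (dag a)" "length w = n"
    "\<psi>w w = inv (\<l> a) \<otimes> inv (\<psi>w (prefix n x)) \<otimes> \<l> a"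
    "cylinder_bound w (\<Phi> n x / D n)"
proof -
  note x = fixed_point_prefix[OF assms(1,2)]
  let ?r = "map x [1..<Suc n]"
  have I: "x k \<in> I" for k
    using x(1) by (simp add: markov_space_def)
  show len: "length w = n"
    by (simp add: w_def word_dag_def)
  have split: "prefix (Suc n) x = a # ?r"
    using x(2) by (simp add: upt_conv_Cons del: upt_Suc)
  have last: "last ?r = a"
    using x(3) assms(2) by (simp add: last_map)
  have "word_dag dag (a # ?r) = w @ [dag a]"
    by (simp add: w_def word_dag_def)
  moreover have "admissible (word_dag dag (a # ?r))"
    using admissible_dag admissible_segment[OF x(1), of 0 "Suc n"] split by metis
  moreover have "hd (w @ [dag a]) = dag a"
    using last assms(2) by (simp add: w_def word_dag_def hd_append hd_rev last_map del: upt_Suc)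
  ultimately show "chain_path (dag a) w (dag a)"
    by (simp add: chain_path_def)
  have sub: "set ?r \<subseteq> I" "set (prefix n x) \<subseteq> I" "{a} \<subseteq> I"
    using I x(4) by auto
  define g where "g = \<psi>w (prefix n x)"
  have c: "\<psi>w ?r \<in> carrier G" "g \<in> carrier G" "\<l> a \<in> carrier G"
    unfolding g_def
    by (rule \<psi>w_closed[OF sub(1)], rule \<psi>w_closed[OF sub(2)], rule letter_closed[OF x(4)])
  have "\<l> a \<otimes> \<psi>w ?r = \<psi>w (prefix (Suc n) x)"
    unfolding split by simp
  also have "prefix (Suc n) x = prefix n x @ [a]"
    using x(3) by simp
  also have "\<psi>w (prefix n x @ [a]) = g \<otimes> \<l> a"
    using \<psi>w_append[OF sub(2), of "[a]"] sub(3) c by (simp add: g_def)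
  finally have "\<psi>w ?r = inv (\<l> a) \<otimes> (g \<otimes> \<l> a)"
    using c by (subst inv_solve_left) auto
  then have "inv (\<psi>w ?r) = inv (\<l> a) \<otimes> inv g \<otimes> \<l> a"
    using c by (simp add: inv_mult_group m_assoc)
  then show "\<psi>w w = inv (\<l> a) \<otimes> inv (\<psi>w (prefix n x)) \<otimes> \<l> a"
    unfolding w_def g_def using \<psi>w_dag[OF sub(1)] by simp
  have "shift x \<in> cylinder I A ?r"
    using x(1) by (simp add: cylinder_def markov_space_def shift_def del: upt_Suc)
  moreover have "\<Phi> n (shift x) = \<Phi> n x"
    using assms(1) by (intro orbit_prod_rotate) (simp add: fixed_points_def)
  ultimately show "cylinder_bound w (\<Phi> n x / D n)"
    using cylinder_bound_dag[of ?r "shift x"] admissible_segment[OF x(1), of 1 "Suc n"] assms(2)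
    by (simp add: w_def)
qed

text \<open>The steps of the walk are the pairs \<open>(x, y)\<close> of points of \<open>F\<close>, exchanging \<open>x\<close> and \<open>y\<close>
  reverses a step. A walk is realised by the periodic point that repeats the concatenation of its
  blocks. Blocks have equal lengths and determine their pairs, so different walks of the same length
  give different periodic points, and the walks with value \<open>id\<close> give fixed points over
  \<open>[a] \<times> {id}\<close>.\<close>

theorem fixed_point_sum_ge:
  assumes "amenable G"
    and u: "chain_path a u (dag a)" "\<psi>w u = \<l> a" "cylinder_bound u cu"
    and v: "chain_path (dag a) v a" "\<psi>w v = inv (\<l> a)" "cylinder_bound v cv"
    and F: "finite F" "F \<subseteq> fixed_points a n" "F \<noteq> {}" and n: "0 < n"
  defines "N \<equiv> 2 * n + length u + length v"
    and "q \<equiv> cu * cv / D n ^ 3 * ((\<Sum>x\<in>F. \<Phi> n x)\<^sup>2 / 2)"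
  obtains \<kappa> where "\<kappa> > 0"
    "\<And>j. ennreal (\<kappa> * q ^ 2 ^ Suc j)
      \<le> (\<Sum>\<^sub>\<infinity>z\<in>{z \<in> cylinder I A [a] \<times> {\<one>}. (extension_map G \<psi> ^^ (2 ^ Suc j * N)) z = z}.
            ennreal (orbit_prod (extension_map G \<psi>) (\<lambda>(x, g). \<phi> x) (2 ^ Suc j * N) z))"
proof -
  define \<omega> where "\<omega> = (\<lambda>(x, y). \<Phi> n x * \<Phi> n y)"
  define s where "s = (\<lambda>(x, y). \<psi>w (prefix n x) \<otimes> inv (\<psi>w (prefix n y)))"
  define block where "block = (\<lambda>(x, y). prefix n x @ u @ word_dag dag (map y [1..<Suc n]) @ v)"
  \<comment> \<open>Bounding \<open>\<Phi>\<close> on the cylinder of \<open>x\<close> costs two factors \<open>D n\<close>, on the mirrored \<open>y\<close> one.\<close>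
  define c where "c = cu * cv / D n ^ 3"
  have val: "\<psi>w (prefix n x) \<in> carrier G" if "x \<in> F" for x
    using that F(2) fixed_point_prefix[OF _ n] by (intro \<psi>w_closed) (auto simp: markov_space_def)
  have pos: "0 < \<Phi> n x" if "x \<in> F" for x
    using that F(2) fixed_point_prefix[OF _ n] \<Phi>_pos by blast
  have aI: "a \<in> I"
    using chain_pathD[OF u(1)] by simp
  have la: "\<l> a \<in> carrier G"
    by (rule letter_closed[OF aI])
  have uI: "set u \<subseteq> I" and vI: "set v \<subseteq> I"
    using chain_pathD(1)[OF u(1)] chain_pathD(1)[OF v(1)] by (auto simp: admissible_def)
  have Dn: "0 < D n"
  proof -
    obtain x where "x \<in> F" using F(3) by blast
    then have "chain_path a (prefix n x) a"
      using F(2) fixed_point_prefix[OF _ n] by blast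
    then show ?thesis
      using distortion_pos[OF chain_pathD(1), of a "prefix n x" a] n by simp
  qed
  have c0: "0 \<le> c"
    using u(3) v(3) Dn by (simp add: c_def cylinder_bound_def)
  interpret W: symmetric_walk G "F \<times> F" \<omega> s prod.swap
    using F(1) pos val
    by unfold_locales (auto simp: \<omega>_def s_def inv_mult_group mult.commute less_imp_le)
  have block: "chain_path a (block e) a" "length (block e) = N" "\<psi>w (block e) = s e"
      "cylinder_bound (block e) (c * \<omega> e)"
    if "e \<in> F \<times> F" for e
  proof -
    obtain x y where e: "e = (x, y)" "x \<in> F" "y \<in> F"
      using \<open>e \<in> F \<times> F\<close> by auto
    have xf: "x \<in> fixed_points a n" and yf: "y \<in> fixed_points a n"
      using e F(2) by auto
    note x = fixed_point_prefix[OF xf n] and y = return_path[OF yf n]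
    let ?y = "word_dag dag (map y [1..<Suc n])"
    have b: "block e = prefix n x @ u @ ?y @ v"
      by (simp add: block_def e)
    show "chain_path a (block e) a"
      unfolding b by (intro chain_path_append[OF x(5)] chain_path_append[OF u(1)]
          chain_path_append[OF y(1)] v(1))
    show "length (block e) = N"
      unfolding b using y(2) by (simp add: N_def)
    have sub: "set (prefix n x) \<subseteq> I" "set ?y \<subseteq> I"
      using chain_pathD(1)[OF x(5)] chain_pathD(1)[OF y(1)] by (auto simp: admissible_def)
    \<comment> \<open>The values of the connecting words cancel the conjugation in \<open>return_path\<close>.\<close>
    have "\<psi>w (block e) = \<psi>w (prefix n x) \<otimes> (\<psi>w u \<otimes> (\<psi>w ?y \<otimes> \<psi>w v))"
      unfolding b using sub uI vI by (simp add: \<psi>w_append)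
    also have "\<dots> = \<psi>w (prefix n x) \<otimes> (\<l> a \<otimes> (inv (\<l> a) \<otimes> inv (\<psi>w (prefix n y)) \<otimes> \<l> a \<otimes> inv (\<l> a)))"
      by (simp only: u(2) v(2) y(3))
    also have "\<l> a \<otimes> (inv (\<l> a) \<otimes> inv (\<psi>w (prefix n y)) \<otimes> \<l> a \<otimes> inv (\<l> a)) = inv (\<psi>w (prefix n y))"
    proof -
      have "\<psi>w (prefix n y) \<in> carrier G" by (rule val[OF e(3)])
      then show ?thesis
        using la by (simp add: m_assoc flip: m_assoc[of "\<l> a"])
    qed
    finally show "\<psi>w (block e) = s e"
      by (simp add: s_def e)
    have "cylinder_bound (prefix n x) (\<Phi> n x / (D n)\<^sup>2)"
      using cylinder_bound_self[OF chain_pathD(1)[OF x(5)] _ x(6)] n by simp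
    then have "cylinder_bound (block e) (\<Phi> n x / (D n)\<^sup>2 * (cu * (\<Phi> n y / D n * cv)))"
      unfolding b by (intro cylinder_bound_append u(3) v(3) y(4))
    moreover have "\<Phi> n x / (D n)\<^sup>2 * (cu * (\<Phi> n y / D n * cv)) = c * \<omega> e"
      using Dn by (simp add: c_def \<omega>_def e field_simps power2_eq_square power3_eq_cube)
    ultimately show "cylinder_bound (block e) (c * \<omega> e)" by simp
  qed
  have point: "ennreal (c ^ m * W.walk_mass m \<one>)
      \<le> (\<Sum>\<^sub>\<infinity>z\<in>{z \<in> cylinder I A [a] \<times> {\<one>}. (extension_map G \<psi> ^^ (m * N)) z = z}.
            ennreal (orbit_prod (extension_map G \<psi>) (\<lambda>(x, g). \<phi> x) (m * N) z))"
    (is "_ \<le> infsum ?f ?Z") if m: "0 < m" for m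
  proof -
    define L where "L = {es \<in> W.steps m. W.val es = \<one>}"
    define wd where "wd es = concat (map block es)" for es
    define pt where "pt es = (periodic_point (wd es), \<one>)" for es
    have es: "set es \<subseteq> F \<times> F" "length es = m" "W.val es = \<one>" if "es \<in> L" for es
      using that by (auto simp: L_def W.steps_def)
    have len: "length (wd es) = m * N" if "es \<in> L" for es
    proof -
      have "length (block e) = N" if "e \<in> set es" for e
        using block(2) es(1)[OF \<open>es \<in> L\<close>] that by blast
      then have "map length (map block es) = map (\<lambda>_. N) es"
        by simp
      then show ?thesis
        using es(2)[OF that] by (simp add: wd_def length_concat map_replicate_const sum_list_replicate)
    qed
    have path: "chain_path a (concat (map block es)) a" if "set es \<subseteq> F \<times> F" for es
      using that
    proof (induction es)
      case Nil
      then show ?case using aI by (simp add: chain_path_def admissible_def)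
    next
      case (Cons e es)
      then show ?case by (auto intro!: chain_path_append block(1))
    qed
    have "0 < N"
      using n by (simp add: N_def)
    have wd: "chain_path a (wd es) a" "wd es \<noteq> []" if "es \<in> L" for es
    proof -
      show "chain_path a (wd es) a"
        unfolding wd_def using path es(1)[OF that] by blast
      have "0 < length (wd es)"
        unfolding len[OF that] using m \<open>0 < N\<close> by simp
      then show "wd es \<noteq> []" by simp
    qed
    have trivial: "\<psi>w (wd es) = \<one>" if "es \<in> L" for es
    proof -
      have "\<forall>w\<in>set (map block es). \<l> ` set w \<subseteq> carrier G"
        using es(1)[OF that] chain_pathD(1)[OF block(1)]
        by (fastforce simp: admissible_def intro!: letter_closed)
      then have "\<psi>w (wd es) = word_value G \<psi>w (map block es)"
        unfolding wd_def by (rule word_value_concat)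
      also have "\<dots> = W.val es"
        using es(1)[OF that] block(3) by (induction es) (auto simp: subset_iff)
      finally show ?thesis using es(3)[OF that] by simp
    qed
    have inj: "inj_on pt L"
    proof (rule inj_onI)
      fix es es' assume H: "es \<in> L" "es' \<in> L" "pt es = pt es'"
      have "wd es = wd es'"
        using H periodic_point(4)[OF wd(1,2)] len by (metis pt_def fst_conv)
      then have "map block es = map block es'"
        unfolding wd_def
      proof (rule concat_injective)
        show "length (map block es) = length (map block es')"
          using es(2) H by simp
        show "\<forall>(w, w')\<in>set (zip (map block es) (map block es')). length w = length w'"
        proof (clarify)
          fix w w' assume "(w, w') \<in> set (zip (map block es) (map block es'))"
          then have "w \<in> block ` set es" "w' \<in> block ` set es'"
            by (auto dest: set_zip_leftD set_zip_rightD)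
          then show "length w = length w'"
            using es(1)[OF H(1)] es(1)[OF H(2)] block(2) by blast
        qed
      qed
      moreover have "inj_on block (F \<times> F)"
      proof (rule inj_onI, clarify)
        fix x y x' y'
        assume F': "x \<in> F" "y \<in> F" "x' \<in> F" "y' \<in> F" and eq: "block (x, y) = block (x', y')"
        then have f: "x \<in> fixed_points a n" "y \<in> fixed_points a n"
            "x' \<in> fixed_points a n" "y' \<in> fixed_points a n"
          using F(2) by auto
        have "prefix n x = prefix n x'"
          and dag_eq: "word_dag dag (map y [1..<Suc n]) = word_dag dag (map y' [1..<Suc n])"
          using eq by (simp_all add: block_def word_dag_def del: upt_Suc)
        then have "x = x'"
          using fixed_point_eqI f n by blast
        moreover have "set (map z [1..<Suc n]) \<subseteq> I" if "z \<in> fixed_points a n" for z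
          using admissible_segment[OF fixed_point_prefix(1)[OF that n]] unfolding admissible_def
          by blast
        then have segment: "map y [1..<Suc n] = map y' [1..<Suc n]"
          using word_dag_word_dag dag_eq f by metis
        \<comment> \<open>The segment omits position 0, where both points have the letter \<open>a\<close>.\<close>
        have "y k = y' k" if "k < n" for k
        proof (cases k)
          case 0
          then show ?thesis
            using fixed_point_prefix(2)[OF _ n] f by metis
        next
          case (Suc i)
          then show ?thesis
            using that segment by (metis Suc_le_mono atLeastLessThan_iff le0 less_Suc_eq map_eq_conv
                One_nat_def set_upt)
        qed
        then have "y = y'"
          using fixed_point_eqI[OF f(2,4) n] by simp
        ultimately show "x = x' \<and> y = y'" by simp
      qed
      then have "inj_on block (set es \<union> set es')"
        by (rule inj_on_subset) (use es(1)[OF H(1)] es(1)[OF H(2)] in blast)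
      ultimately show "es = es'"
        by (rule map_inj_on)
    qed
    have sub: "pt ` L \<subseteq> ?Z"
    proof (rule image_subsetI)
      fix es assume "es \<in> L"
      note p = periodic_point[OF wd[OF this]]
      have sp: "periodic_point (wd es) \<in> markov_space I A"
        by (rule cylinder_in_space[OF p(1)])
      have "(extension_map G \<psi> ^^ (m * N)) (pt es) = pt es"
        unfolding pt_def extension_map_funpow[OF sp one_closed]
        using p(3,4) trivial[OF \<open>es \<in> L\<close>] len[OF \<open>es \<in> L\<close>] by simp
      then show "pt es \<in> ?Z"
        using p(2) sp by (simp add: pt_def cylinder_def)
    qed
    have fin: "finite L"
      unfolding L_def using W.finite_walks by simp
    have "c ^ m * W.walk_mass m \<one> = (\<Sum>es\<in>L. c ^ m * W.weight es)"
      by (simp add: W.walk_mass_def L_def sum_distrib_left)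
    also have "\<dots> \<le> (\<Sum>es\<in>L. \<Phi> (m * N) (fst (pt es)))"
    proof (rule sum_mono)
      fix es assume "es \<in> L"
      have "cylinder_bound (wd es) (prod_list (map (\<lambda>e. c * \<omega> e) es))"
        unfolding wd_def using es(1)[OF \<open>es \<in> L\<close>] block(4) by (intro cylinder_bound_concat) auto
      also have "prod_list (map (\<lambda>e. c * \<omega> e) es) = c ^ length es * W.weight es"
        by (induction es) (auto simp: W.weight_def)
      finally show "c ^ m * W.weight es \<le> \<Phi> (m * N) (fst (pt es))"
        using periodic_point(1)[OF wd[OF \<open>es \<in> L\<close>]] len[OF \<open>es \<in> L\<close>] es(2)[OF \<open>es \<in> L\<close>]
        by (simp add: cylinder_bound_def pt_def)
    qed
    finally have "ennreal (c ^ m * W.walk_mass m \<one>) \<le> ennreal (\<Sum>es\<in>L. \<Phi> (m * N) (fst (pt es)))"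
      by (rule ennreal_leI)
    also have "\<dots> = (\<Sum>es\<in>L. ennreal (\<Phi> (m * N) (fst (pt es))))"
    proof (rule sum_ennreal[symmetric])
      fix es assume "es \<in> L"
      then show "0 \<le> \<Phi> (m * N) (fst (pt es))"
        using \<Phi>_pos[OF cylinder_in_space[OF periodic_point(1)[OF wd]]] by (simp add: pt_def less_imp_le)
    qed
    also have "\<dots> = (\<Sum>es\<in>L. ?f (pt es))"
      by (simp add: pt_def orbit_prod_extension)
    also have "\<dots> = (\<Sum>z\<in>pt ` L. ?f z)"
      by (simp add: sum.reindex[OF inj])
    also have "\<dots> \<le> infsum ?f ?Z"
      using infsum_ennreal_mono[OF sub, of ?f ?f] fin by simp
    finally show ?thesis .
  qed
  have mass: "(\<Sum>e\<in>F \<times> F. \<omega> e) = (\<Sum>x\<in>F. \<Phi> n x)\<^sup>2"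
    by (simp add: \<omega>_def sum.cartesian_product power2_eq_square sum_product)
  obtain \<kappa> where \<kappa>: "\<kappa> > 0" "\<And>j. \<kappa> * ((\<Sum>x\<in>F. \<Phi> n x)\<^sup>2 / 2) ^ 2 ^ Suc j \<le> W.walk_mass (2 ^ Suc j) \<one>"
    using W.amenable_return_mass[OF assms(1)] unfolding mass by blast
  show thesis
  proof (rule that[OF \<kappa>(1)])
    fix j
    have "\<kappa> * q ^ 2 ^ Suc j = c ^ 2 ^ Suc j * (\<kappa> * ((\<Sum>x\<in>F. \<Phi> n x)\<^sup>2 / 2) ^ 2 ^ Suc j)"
      by (simp only: q_def c_def[symmetric] power_mult_distrib mult_ac)
    also have "\<dots> \<le> c ^ 2 ^ Suc j * W.walk_mass (2 ^ Suc j) \<one>"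
      using c0 \<kappa>(2) by (intro mult_left_mono) auto
    finally show "ennreal (\<kappa> * q ^ 2 ^ Suc j)
      \<le> (\<Sum>\<^sub>\<infinity>z\<in>{z \<in> cylinder I A [a] \<times> {\<one>}. (extension_map G \<psi> ^^ (2 ^ Suc j * N)) z = z}.
            ennreal (orbit_prod (extension_map G \<psi>) (\<lambda>(x, g). \<phi> x) (2 ^ Suc j * N) z))"
      using point[of "2 ^ Suc j"] by (meson ennreal_leI order_trans zero_less_numeral zero_less_power)
  qed
qed

end

section \<open>Comparison of the growth rates\<close>

lemma extended_ln_ennreal: "0 < r \<Longrightarrow> extended_ln (ennreal r) = ereal (ln r)"
  by (simp add: extended_ln_def)

lemma extended_ln_mono:
  assumes "s \<le> t"
  shows "extended_ln s \<le> extended_ln t"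
proof (cases "s = 0 \<or> t = \<infinity>")
  case True
  then show ?thesis by (auto simp: extended_ln_def)
next
  case False
  then have t: "t < \<infinity>" and s: "0 < s" "s < \<infinity>"
    using assms by (auto simp: less_top[symmetric] top_unique zero_less_iff_neq_zero)
  then have "0 < enn2real s" "enn2real s \<le> enn2real t"
    using assms by (auto simp: enn2real_positive_iff intro!: enn2real_mono)
  then have "ln (enn2real s) \<le> ln (enn2real t)"
    by simp
  then show ?thesis
    using s t assms by (auto simp: extended_ln_def)
qed

lemma exp_less_of_less_extended_ln:
  assumes "ereal b < extended_ln s"
  shows "ennreal (exp b) < s"
proof (rule ccontr)
  assume "\<not> ennreal (exp b) < s"
  then have "extended_ln s \<le> extended_ln (ennreal (exp b))"
    by (intro extended_ln_mono) simp
  then show False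
    using assms by (simp add: extended_ln_ennreal)
qed

text \<open>Lengths that are powers of 2 times \<open>N\<close> are enough to bound a limes superior from below.\<close>

lemma limsup_growth_ge:
  fixes Z :: "nat \<Rightarrow> ennreal"
  assumes "0 < \<kappa>" "0 < q" "0 < N"
    and Z: "\<And>j. ennreal (\<kappa> * q ^ 2 ^ Suc j) \<le> Z (2 ^ Suc j * N)"
  shows "ereal (ln q / real N) \<le> limsup (\<lambda>n. extended_ln (Z n) / ereal (real n))"
proof -
  define r where "r j = 2 ^ Suc j * N" for j
  have "strict_mono r"
    unfolding r_def using assms(3) by (intro strict_monoI) simp
  have lim: "(\<lambda>j. (ln \<kappa> / real N) * (1 / 2) ^ Suc j + ln q / real N) \<longlonglongrightarrow> (ln \<kappa> / real N) * 0 + ln q / real N"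
    by (intro tendsto_intros LIMSEQ_Suc LIMSEQ_realpow_zero) auto
  have "ereal (ln q / real N) = limsup (\<lambda>j. ereal ((ln \<kappa> / real N) * (1 / 2) ^ Suc j + ln q / real N))"
    using lim by (intro lim_imp_Limsup[symmetric]) (auto intro: tendsto_ereal)
  also have "\<dots> \<le> limsup ((\<lambda>n. extended_ln (Z n) / ereal (real n)) \<circ> r)"
  proof (intro Limsup_mono always_eventually allI)
    fix j
    have rj: "0 < real (r j)" "real (r j) = 2 ^ Suc j * real N"
      using assms(3) by (auto simp: r_def)
    have "ln (\<kappa> * q ^ 2 ^ Suc j) = ln \<kappa> + 2 ^ Suc j * ln q"
      using assms(1,2) by (simp add: ln_mult ln_realpow del: power_Suc)
    then have "(ln \<kappa> / real N) * (1 / 2) ^ Suc j + ln q / real N = ln (\<kappa> * q ^ 2 ^ Suc j) / real (r j)"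
      using assms(3) by (simp add: rj(2) field_simps power_one_over)
    also have "ereal \<dots> = extended_ln (ennreal (\<kappa> * q ^ 2 ^ Suc j)) / ereal (real (r j))"
      using assms(1,2) rj(1) by (subst extended_ln_ennreal) auto
    also have "\<dots> \<le> extended_ln (Z (r j)) / ereal (real (r j))"
      using Z[of j] rj(1) unfolding r_def[symmetric]
      by (intro ereal_divide_right_mono extended_ln_mono) auto
    finally show "ereal ((ln \<kappa> / real N) * (1 / 2) ^ Suc j + ln q / real N)
        \<le> ((\<lambda>n. extended_ln (Z n) / ereal (real n)) \<circ> r) j"
      by simp
  qed
  also have "\<dots> \<le> limsup (\<lambda>n. extended_ln (Z n) / ereal (real n))"
    by (rule limsup_subseq_mono[OF \<open>strict_mono r\<close>])
  finally show ?thesis .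
qed

text \<open>The limit forces \<open>D n > 0\<close> for large \<open>n\<close>, where the logarithm of the root is
  \<open>ln (D n) / n\<close>.\<close>

lemma ln_over_index_tendsto:
  fixes D :: "nat \<Rightarrow> real"
  assumes "(\<lambda>n. root n (D n)) \<longlonglongrightarrow> 1"
  shows "(\<lambda>n. ln (D n) / real n) \<longlonglongrightarrow> 0"
proof -
  have "(\<lambda>n. ln (root n (D n))) \<longlonglongrightarrow> ln 1"
    by (intro tendsto_ln assms) simp
  moreover have "\<forall>\<^sub>F n in sequentially. ln (root n (D n)) = ln (D n) / real n"
    using order_tendstoD(1)[OF assms zero_less_one] eventually_gt_at_top[of 0]
  proof eventually_elim
    case (elim n)
    then show ?case
      by (simp add: ln_root)
  qed
  ultimately show ?thesis
    using tendsto_cong by fastforce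
qed

context symmetric_chain
begin

lemma extension_pressure_le:
  "periodic_growth (extension_map G \<psi>) (\<lambda>(x, g). \<phi> x) (cylinder I A [a] \<times> {\<one>})
    \<le> periodic_growth shift \<phi> (cylinder I A [a])"
  unfolding periodic_growth_def
proof (intro Limsup_mono eventually_mono[OF eventually_gt_at_top[of 0]])
  fix n :: nat assume "0 < n"
  let ?Z = "{z \<in> cylinder I A [a] \<times> {\<one>}. (extension_map G \<psi> ^^ n) z = z}"
  have "(\<Sum>\<^sub>\<infinity>z\<in>?Z. ennreal (orbit_prod (extension_map G \<psi>) (\<lambda>(x, g). \<phi> x) n z))
      = (\<Sum>\<^sub>\<infinity>z\<in>?Z. ennreal (\<Phi> n (fst z)))"
    by (intro infsum_cong) (auto simp: orbit_prod_extension)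
  also have "\<dots> = (\<Sum>\<^sub>\<infinity>x\<in>fst ` ?Z. ennreal (\<Phi> n x))"
    by (subst infsum_reindex) (auto simp: inj_on_def comp_def)
  also have "\<dots> \<le> (\<Sum>\<^sub>\<infinity>x\<in>{x \<in> cylinder I A [a]. (shift ^^ n) x = x}. ennreal (\<Phi> n x))"
    by (intro infsum_ennreal_mono)
       (auto simp: extension_map_funpow[OF cylinder_in_space])
  finally show "extended_ln (\<Sum>\<^sub>\<infinity>z\<in>?Z. ennreal (orbit_prod (extension_map G \<psi>) (\<lambda>(x, g). \<phi> x) n z))
        / ereal (real n)
      \<le> extended_ln (\<Sum>\<^sub>\<infinity>x\<in>{x \<in> cylinder I A [a]. (shift ^^ n) x = x}. ennreal (\<Phi> n x))
        / ereal (real n)"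
    using \<open>0 < n\<close> by (intro ereal_divide_right_mono extended_ln_mono) auto
qed

text \<open>In the bound of \<open>fixed_point_sum_ge\<close> only \<open>M\<close> and \<open>D n\<close> depend on \<open>n\<close>; the connecting words
  and their weights do not, and are negligible after division by the length.\<close>

lemma extension_pressure_ge:
  assumes "amenable G" "extension_transitive I A G \<psi>" "a \<in> I"
    and D: "(\<lambda>n. root n (D n)) \<longlonglongrightarrow> 1"
    and b: "ereal b < periodic_growth shift \<phi> (cylinder I A [a])" and "b' < b"
  shows "ereal b' \<le> periodic_growth (extension_map G \<psi>) (\<lambda>(x, g). \<phi> x) (cylinder I A [a] \<times> {\<one>})"
proof -
  have la: "\<l> a \<in> carrier G" and da: "dag a \<in> I"
    using assms(3) by (auto intro: letter_closed dag_in)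
  obtain u where u: "u \<noteq> []" "chain_path a u (dag a)" "\<psi>w u = \<l> a"
    using transitive_path[OF assms(2,3) da la] .
  obtain v where v: "v \<noteq> []" "chain_path (dag a) v a" "\<psi>w v = inv (\<l> a)"
    using transitive_path[OF assms(2) da assms(3) inv_closed[OF la]] .
  obtain cu where cu: "0 < cu" "cylinder_bound u cu"
    using cylinder_bound_exists[OF chain_pathD(1)[OF u(2)] u(1)] .
  obtain cv where cv: "0 < cv" "cylinder_bound v cv"
    using cylinder_bound_exists[OF chain_pathD(1)[OF v(2)] v(1)] .
  define l where "l = length u + length v"
  have inverse: "(\<lambda>n. 1 / real n) \<longlonglongrightarrow> 0"
    by (rule lim_1_over_n)
  have "(\<lambda>n. (2 * b - 3 * (ln (D n) / real n) + ln (cu * cv / 2) * (1 / real n)) / (2 + real l * (1 / real n)))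
      \<longlonglongrightarrow> (2 * b - 3 * 0 + ln (cu * cv / 2) * 0) / (2 + real l * 0)"
    by (intro tendsto_intros ln_over_index_tendsto[OF D] inverse) simp
  then have "\<forall>\<^sub>F n in sequentially. b' <
      (2 * b - 3 * (ln (D n) / real n) + ln (cu * cv / 2) * (1 / real n)) / (2 + real l * (1 / real n))"
    using \<open>b' < b\<close> by (intro order_tendstoD(1)) auto
  then have ev: "\<forall>\<^sub>F n in sequentially. 0 < n \<and> 0 < D n \<and>
      b' < (2 * real n * b - 3 * ln (D n) + ln (cu * cv / 2)) / (2 * real n + real l)"
    using eventually_gt_at_top[of 0] order_tendstoD(1)[OF D zero_less_one]
  proof eventually_elim
    case (elim n)
    have "(2 * b - 3 * (ln (D n) / real n) + ln (cu * cv / 2) * (1 / real n)) / (2 + real l * (1 / real n))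
        = (2 * real n * b - 3 * ln (D n) + ln (cu * cv / 2)) / (2 * real n + real l)"
    proof -
      have "2 * real n * b - 3 * ln (D n) + ln (cu * cv / 2)
          = real n * (2 * b - 3 * (ln (D n) / real n) + ln (cu * cv / 2) * (1 / real n))"
        "2 * real n + real l = real n * (2 + real l * (1 / real n))"
        using elim(2) by (simp_all add: algebra_simps)
      then show ?thesis
        using elim(2) by simp
    qed
    then show ?case
      using elim by simp
  qed
  have "\<exists>\<^sub>F n in sequentially. ereal b <
      extended_ln (\<Sum>\<^sub>\<infinity>x\<in>fixed_points a n. ennreal (\<Phi> n x)) / ereal (real n)"
  proof (rule ccontr)
    assume "\<not> ?thesis"
    then have "periodic_growth shift \<phi> (cylinder I A [a]) \<le> ereal b"
      unfolding periodic_growth_def fixed_points_def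
      by (intro Limsup_bounded) (simp add: not_frequently not_less)
    then show False
      using b by simp
  qed
  then obtain n where n: "0 < n" "0 < D n"
      and b': "b' < (2 * real n * b - 3 * ln (D n) + ln (cu * cv / 2)) / (2 * real n + real l)"
      and growth: "ereal b < extended_ln (\<Sum>\<^sub>\<infinity>x\<in>fixed_points a n. ennreal (\<Phi> n x)) / ereal (real n)"
    using frequently_eventually_frequently[OF _ ev] frequently_ex by blast
  have "ereal (b * real n) < extended_ln (\<Sum>\<^sub>\<infinity>x\<in>fixed_points a n. ennreal (\<Phi> n x))"
    using growth n(1) by (simp add: ereal_less_divide_pos mult.commute)
  then have "ennreal (exp (b * real n)) < (\<Sum>\<^sub>\<infinity>x\<in>fixed_points a n. ennreal (\<Phi> n x))"
    by (rule exp_less_of_less_extended_ln)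
  also have "\<dots> = (SUP F\<in>{F. finite F \<and> F \<subseteq> fixed_points a n}. \<Sum>x\<in>F. ennreal (\<Phi> n x))"
    by (intro nonneg_infsum_complete) simp
  finally obtain F where F: "finite F" "F \<subseteq> fixed_points a n"
      and less: "ennreal (exp (b * real n)) < (\<Sum>x\<in>F. ennreal (\<Phi> n x))"
    unfolding less_SUP_iff by blast
  have "0 \<le> \<Phi> n x" if "x \<in> F" for x
    using F(2) that n(1) fixed_point_prefix(1) \<Phi>_pos by (meson less_imp_le subsetD)
  then have mass: "exp (b * real n) < (\<Sum>x\<in>F. \<Phi> n x)"
    using less by (simp add: sum_ennreal ennreal_less_iff)
  then have "F \<noteq> {}"
    by (auto simp: not_less)
  define N where "N = 2 * n + length u + length v"
  define q where "q = cu * cv / D n ^ 3 * ((\<Sum>x\<in>F. \<Phi> n x)\<^sup>2 / 2)"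
  have mass_pos: "0 < (\<Sum>x\<in>F. \<Phi> n x)"
    using mass exp_gt_zero less_trans by blast
  have "0 < q" "0 < N"
    using cu(1) cv(1) n mass_pos by (auto simp: q_def N_def)
  have "ln q = ln (cu * cv / 2) - 3 * ln (D n) + 2 * ln (\<Sum>x\<in>F. \<Phi> n x)"
    using cu(1) cv(1) n(2) mass_pos by (simp add: q_def ln_mult ln_div ln_realpow)
  moreover have "b * real n \<le> ln (\<Sum>x\<in>F. \<Phi> n x)"
    using mass mass_pos by (simp add: ln_ge_iff)
  ultimately have "2 * real n * b - 3 * ln (D n) + ln (cu * cv / 2) \<le> ln q"
    by (simp add: mult.commute)
  then have "(2 * real n * b - 3 * ln (D n) + ln (cu * cv / 2)) / (2 * real n + real l) \<le> ln q / real N"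
    using divide_right_mono[of _ "ln q" "real N"] by (simp add: N_def l_def add.assoc)
  then have "ereal b' \<le> ereal (ln q / real N)"
    using b' by simp
  also obtain \<kappa> where "\<kappa> > 0"
    "\<And>j. ennreal (\<kappa> * q ^ 2 ^ Suc j)
      \<le> (\<Sum>\<^sub>\<infinity>z\<in>{z \<in> cylinder I A [a] \<times> {\<one>}. (extension_map G \<psi> ^^ (2 ^ Suc j * N)) z = z}.
            ennreal (orbit_prod (extension_map G \<psi>) (\<lambda>(x, g). \<phi> x) (2 ^ Suc j * N) z))"
    using fixed_point_sum_ge[OF assms(1) u(2,3) cu(2) v(2,3) cv(2) F \<open>F \<noteq> {}\<close> n(1)]
    unfolding q_def N_def by blast
  then have "ereal (ln q / real N)
      \<le> periodic_growth (extension_map G \<psi>) (\<lambda>(x, g). \<phi> x) (cylinder I A [a] \<times> {\<one>})"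
    unfolding periodic_growth_def
    by (intro limsup_growth_ge[OF _ \<open>0 < q\<close> \<open>0 < N\<close>])
  finally show ?thesis .
qed

end

theorem theorem4p1:
  fixes I :: "'i set" and A :: "'i \<Rightarrow> 'i \<Rightarrow> nat"
    and G :: "('g, 'm) monoid_scheme"
    and \<psi> :: "(nat \<Rightarrow> 'i) \<Rightarrow> 'g"
    and \<phi> :: "(nat \<Rightarrow> 'i) \<Rightarrow> real"
    and dag :: "'i \<Rightarrow> 'i"
    and a :: 'i
  assumes "transition_matrix I A"
    and "chain_mixing I A"
    and "group G" and "countable (carrier G)"
    and "\<psi> \<in> markov_space I A \<rightarrow> carrier G" and "constant_on_letters I A \<psi>"
    and "extension_transitive I A G \<psi>"
    and "symmetric_extension I A G \<psi> dag"
    and "\<forall>x\<in>markov_space I A. \<phi> x > 0"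
    and "weakly_symmetric I A dag \<phi>"
    and "a \<in> I"
    and "\<bar>gurevic_pressure I A \<phi> a\<bar> \<noteq> \<infinity>"
    and "amenable G"
  shows "extension_gurevic_pressure I A G \<psi> \<phi> a = gurevic_pressure I A \<phi> a"
proof -
  obtain D where D: "(\<lambda>n. root n (D n)) \<longlonglongrightarrow> 1"
    and distortion: "\<forall>n. \<forall>w\<in>words I A n. \<forall>x\<in>cylinder I A w. \<forall>y\<in>cylinder I A (word_dag dag w).
           orbit_prod shift \<phi> n x / orbit_prod shift \<phi> n y \<le> D n"
    using assms(10) unfolding weakly_symmetric_def by blast
  interpret group G
    by (rule assms(3))
  interpret symmetric_chain G I A \<psi> \<phi> dag D
    by unfold_locales (use assms(1,5,6,8,9) distortion in auto)
  show ?thesis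
  proof (rule antisym)
    show "extension_gurevic_pressure I A G \<psi> \<phi> a \<le> gurevic_pressure I A \<phi> a"
      unfolding extension_gurevic_pressure_def gurevic_pressure_def
      by (rule extension_pressure_le)
    show "gurevic_pressure I A \<phi> a \<le> extension_gurevic_pressure I A G \<psi> \<phi> a"
    proof (rule ereal_le_real)
      fix z :: real
      assume upper: "extension_gurevic_pressure I A G \<psi> \<phi> a \<le> ereal z"
      show "gurevic_pressure I A \<phi> a \<le> ereal z"
      proof (rule ccontr)
        assume "\<not> gurevic_pressure I A \<phi> a \<le> ereal z"
        then obtain b where b: "ereal z < ereal b" "ereal b < gurevic_pressure I A \<phi> a"
          using ereal_dense2[of "ereal z" "gurevic_pressure I A \<phi> a"] by (auto simp: not_le)
        then obtain b' where b': "z < b'" "b' < b"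
          using dense[of z b] by auto
        have "ereal b' \<le> extension_gurevic_pressure I A G \<psi> \<phi> a"
          unfolding extension_gurevic_pressure_def
          using assms(13,7,11) D b(2) b'(2) unfolding gurevic_pressure_def
          by (rule extension_pressure_ge)
        then have "ereal b' \<le> ereal z"
          using upper by (rule order_trans)
        then show False
          using b'(1) by simp
      qed
    qed
  qed
qed

end
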